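(* Let $n$ be a positive integer and let $k,m,a$ be complex numbers such that all the functions below are defined. Then $$\sum _{p=1}^n 3^p \left(a^k+\sqrt[3]{-1} \left(i 3^p\right)^k e^{i 3^p m} \left(\Phi \left(\sqrt[3]{-1}\, e^{i 3^p m},-k,1-i 3^{-p} a\right)-\sqrt[3]{-1}\, \Phi \left(-(-1)^{2/3} e^{i 3^p m},-k,1-i 3^{-p} a\right)\right)\right)$$ $$=\frac{3}{2} \left(\left(-1+3^n\right) a^k+2 (3 i)^k e^{3 i m}\, \Phi \left(-e^{3 i m},-k,1-\tfrac{i a}{3}\right)-2\cdot 3^n \left(i 3^{1+n}\right)^k e^{i 3^{1+n} m}\, \Phi \left(-e^{i 3^{1+n} m},-k,1-i 3^{-1-n} a\right)\right).$$
   Context: $\Phi(z,s,v)$ is the Hurwitz–Lerch zeta function: $\Phi(z,s,v)=\sum_{j=0}^{\infty}\frac{z^j}{(j+v)^s}$ for $v\notin\{0,-1,-2,\dots\}$ and $|z|<1$ (or $|z|=1$, $\operatorname{Re}s>1$), and by analytic continuation (principal branch, cut along $z\in[1,\infty)$) for other values; $\Phi(1,s,v)$ is the Hurwitz zeta function $\zeta(s,v)$. Powers and roots are principal values; in particular $\sqrt[3]{-1}=e^{i\pi/3}$ and $(-1)^{2/3}=e^{2i\pi/3}$. *)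

theory Defs
  imports "HOL-Complex_Analysis.Complex_Analysis"
begin

definition lerch_series :: "complex \<Rightarrow> complex \<Rightarrow> complex \<Rightarrow> complex" where
  "lerch_series z s v = (\<Sum>j. z ^ j / (of_nat j + v) powr s)"

definition lerch_slit_plane :: "complex set" where
  "lerch_slit_plane = - (complex_of_real ` {1..})"

(* Analytic continuation in z, for fixed s and v.  The slit plane is connected and contains
   the unit disc, so the chosen function is uniquely determined on the slit plane. *)
definition lerch_continuation :: "complex \<Rightarrow> complex \<Rightarrow> complex \<Rightarrow> complex" where
  "lerch_continuation s v =
     (SOME f. f holomorphic_on lerch_slit_plane \<and>
              (\<forall>z\<in>ball 0 1. f z = lerch_series z s v))"

(* Analytic continuation in s, for fixed v; uniquely determined for s \<noteq> 1. *)
definition hurwitz_zeta :: "complex \<Rightarrow> complex \<Rightarrow> complex" where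
  "hurwitz_zeta s v =
     (SOME f. f holomorphic_on - {1} \<and>
              (\<forall>t. Re t > 1 \<longrightarrow> f t = lerch_series 1 t v)) s"

definition lerch_phi :: "complex \<Rightarrow> complex \<Rightarrow> complex \<Rightarrow> complex" where
  "lerch_phi z s v =
     (if norm z < 1 \<or> norm z = 1 \<and> Re s > 1 then lerch_series z s v
      else if z = 1 then hurwitz_zeta s v
      else lerch_continuation s v z)"

(* The arguments at which lerch_phi has a mathematical meaning.  The point z = 1 lies on the
   cut but carries the value of the Hurwitz zeta function, which has a pole at s = 1; on the
   rest of the cut the principal branch is left undefined. *)
definition lerch_phi_defined :: "complex \<Rightarrow> complex \<Rightarrow> complex \<Rightarrow> bool" where
  "lerch_phi_defined z s v \<longleftrightarrow>
     v \<notin> \<int>\<^sub>\<le>\<^sub>0 \<and> (z \<in> lerch_slit_plane \<or> z = 1 \<and> s \<noteq> 1)"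

end

theory Submission
  imports Defs
begin

text \<open>
  The sum telescopes.  Let \<open>\<zeta>\<close> be a primitive cube root of unity.  Orthogonality of the cube roots
  of unity, applied to the terms \<open>y ^ j / (j + v) powr s\<close>, keeps the indices \<open>j = 3 * l + 2\<close> and
  gives the trisection identity (\<open>lerch_trisection\<close>)
  \[ \Phi(y,s,v) + \zeta\,\Phi(\zeta y,s,v) + \zeta^2\,\Phi(\zeta^2 y,s,v)
     = 3^{1-s} y^2\,\Phi(y^3, s, (v+2)/3). \]
  For \<open>y = - exp (\<i> * 3 ^ p * m)\<close>, \<open>v = 1 - \<i> * a / 3 ^ p\<close>, \<open>s = - k\<close> and
  \<open>\<zeta> = (-1) powr (2/3)\<close> the last two terms on the left are, up to a common factor, the two values of
  \<open>\<Phi>\<close> in the \<open>p\<close>-th summand, and \<open>y ^ 3\<close> and \<open>(v + 2) / 3\<close> are the values of \<open>y\<close> and \<open>v\<close> for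
  \<open>p + 1\<close>.  So the \<open>p\<close>-th summand is \<open>3 ^ p * a powr k + S p - S (p + 1)\<close>, where
  \<open>S p = 3 ^ p * (\<i> * 3 ^ p) powr k * exp (\<i> * 3 ^ p * m) * \<Phi>(- exp (\<i> * 3 ^ p * m), - k, v)\<close>.

  The work lies in proving the trisection identity wherever \<open>\<Phi>\<close> is defined, with \<open>\<Phi>\<close> given by
  continuations that must first be shown to exist.  If no argument meets the cut, the identity
  continues from the unit disc in the variable \<open>y\<close>.  If one of the arguments is 1, then all of them
  are cube roots of unity, the value at 1 is the Hurwitz zeta function, and the identity continues
  from \<open>Re s > 1\<close> in the variable \<open>s\<close>.  The second case needs the continuation in \<open>z\<close>, taken at a
  point of the unit circle, to be holomorphic in \<open>s\<close>.  Therefore a joint continuation is constructed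
  (\<open>is_lerch_continuation_exists\<close>): with \<open>q\<close> the rational function
  \<open>q y = (\<Sum>j. (j + v) ^ N * y ^ j)\<close>,
  \[ \Phi(z,s,v) = \frac{1}{\Gamma(s+N)} \int_0^\infty t^{s+N-1} e^{-vt} q(z e^{-t})\,dt \]
  holds for \<open>Re v > 0\<close> and \<open>Re s > - N\<close>, and the right-hand side is holomorphic in \<open>z\<close> on the slit
  plane and in \<open>s\<close> on the half plane.  The Hurwitz zeta function is continued by the recurrence
  \<open>hurwitz_series_recurrence\<close>, which comes from Taylor expansion of the telescoping differences of
  \<open>(j + v) powr (1 - s)\<close>.
\<close>

section \<open>Integrals that depend holomorphically on a parameter\<close>

text \<open>Differentiation under the integral sign.  Cauchy's inequality turns the local majorant of the
  integrand into a majorant of its \<open>z\<close>-derivative, hence of its difference quotients,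
  and dominated convergence applies to these along every sequence that tends to the point.\<close>

lemma holomorphic_on_lebesgue_integral:
  fixes f :: "complex \<Rightarrow> 'a \<Rightarrow> complex"
  assumes S: "open S"
    and meas: "\<And>z. z \<in> S \<Longrightarrow> f z \<in> borel_measurable M"
    and hol: "\<And>t. t \<in> space M \<Longrightarrow> (\<lambda>z. f z t) holomorphic_on S"
    and dom: "\<And>z0. z0 \<in> S \<Longrightarrow> \<exists>r>0. \<exists>g. integrable M g \<and> cball z0 r \<subseteq> S \<and>
                 (\<forall>z\<in>cball z0 r. \<forall>t\<in>space M. norm (f z t) \<le> g t)"
  shows "(\<lambda>z. \<integral>t. f z t \<partial>M) holomorphic_on S"
proof -
  have "\<exists>D. ((\<lambda>z. \<integral>t. f z t \<partial>M) has_field_derivative D) (at z0)" if z0: "z0 \<in> S" for z0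
  proof -
    obtain r g where r: "r > 0" and g: "integrable M g" and sub: "cball z0 r \<subseteq> S"
      and bd: "\<And>z t. z \<in> cball z0 r \<Longrightarrow> t \<in> space M \<Longrightarrow> norm (f z t) \<le> g t"
      using dom[OF z0] by blast
    have int: "integrable M (f z)" if "z \<in> cball z0 r" for z
      by (rule Bochner_Integration.integrable_bound[OF g])
         (use that sub bd meas in \<open>auto intro!: AE_I2 order_trans[OF _ abs_ge_self]\<close>)
    have derf: "((\<lambda>z. f z t) has_field_derivative deriv (\<lambda>z. f z t) z) (at z)"
      if "t \<in> space M" "z \<in> S" for t z
      using hol[OF that(1)] S that(2) by (rule holomorphic_derivI)
    have bdd: "norm (deriv (\<lambda>z. f z t) z) \<le> g t / (r/2)"
      if t: "t \<in> space M" and z: "z \<in> cball z0 (r/2)" for t z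
    proof -
      have s: "cball z (r/2) \<subseteq> cball z0 r"
        using z by (auto simp: dist_norm) (smt (verit) dist_norm dist_triangle field_sum_of_halves)
      have "norm ((deriv ^^ 1) (\<lambda>z. f z t) z) \<le> fact 1 * g t / (r/2) ^ 1"
      proof (rule Cauchy_inequality)
        have h: "(\<lambda>z. f z t) holomorphic_on cball z (r/2)"
          using hol[OF t] by (rule holomorphic_on_subset) (use s sub in auto)
        show "(\<lambda>z. f z t) holomorphic_on ball z (r/2)"
          using h by (rule holomorphic_on_subset) auto
        show "continuous_on (cball z (r/2)) (\<lambda>z. f z t)"
          using h by (rule holomorphic_on_imp_continuous_on)
        show "norm (f x t) \<le> g t" if "norm (z - x) = r/2" for x
          using bd[OF _ t, of x] s that by (auto simp: dist_norm)
      qed (use r in auto)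
      thus ?thesis by simp
    qed
    have quot: "norm ((f z t - f z0 t) / (z - z0)) \<le> g t / (r/2)"
      if t: "t \<in> space M" and z: "z \<in> cball z0 (r/2)" "z \<noteq> z0" for t z
    proof -
      have "norm (f z t - f z0 t) \<le> g t / (r/2) * norm (z - z0)"
      proof (rule field_differentiable_bound[where S = "cball z0 (r/2)"])
        fix w assume w: "w \<in> cball z0 (r/2)"
        have "w \<in> S" using w sub r by auto
        thus "((\<lambda>z. f z t) has_field_derivative deriv (\<lambda>z. f z t) w) (at w within cball z0 (r/2))"
          using derf[OF t] by (blast intro: has_field_derivative_at_within)
      qed (use bdd[OF t] z r in auto)
      thus ?thesis using z r by (simp add: norm_divide divide_simps)
    qed
    define D where "D = (\<integral>t. deriv (\<lambda>z. f z t) z0 \<partial>M)"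
    have lim: "(\<lambda>n. \<integral>t. (f (X n) t - f z0 t) / (X n - z0) \<partial>M) \<longlonglongrightarrow> D"
      if X: "\<And>n. X n \<in> cball z0 (r/2)" "\<And>n. X n \<noteq> z0" "X \<longlonglongrightarrow> z0" for X
      unfolding D_def
    proof (rule integral_dominated_convergence)
      have pt: "(\<lambda>n. (f (X n) t - f z0 t) / (X n - z0)) \<longlonglongrightarrow> deriv (\<lambda>z. f z t) z0"
        if "t \<in> space M" for t
      proof -
        have "((\<lambda>z. (f z t - f z0 t) / (z - z0)) \<longlongrightarrow> deriv (\<lambda>z. f z t) z0) (at z0)"
          using derf[OF that z0] by (simp add: has_field_derivative_iff)
        moreover have "filterlim X (at z0) sequentially"
          using X by (auto simp: filterlim_at intro!: always_eventually)
        ultimately show ?thesis by (rule filterlim_compose)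
      qed
      show meas': "(\<lambda>t. (f (X n) t - f z0 t) / (X n - z0)) \<in> borel_measurable M" for n
      proof -
        have "X n \<in> S" using X(1)[of n] sub r by auto
        thus ?thesis using meas[OF z0] meas[of "X n"] by measurable
      qed
      show "(\<lambda>t. deriv (\<lambda>z. f z t) z0) \<in> borel_measurable M"
        by (rule borel_measurable_LIMSEQ_metric[OF meas' pt])
      show "integrable M (\<lambda>t. g t / (r/2))" using g by simp
      show "AE t in M. (\<lambda>n. (f (X n) t - f z0 t) / (X n - z0)) \<longlonglongrightarrow> deriv (\<lambda>z. f z t) z0"
        using pt by (auto intro!: AE_I2)
      show "AE t in M. norm ((f (X n) t - f z0 t) / (X n - z0)) \<le> g t / (r/2)" for n
        using quot[OF _ X(1)[of n] X(2)[of n]] by (auto intro!: AE_I2)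
    qed
    have "((\<lambda>z. ((\<integral>t. f z t \<partial>M) - (\<integral>t. f z0 t \<partial>M)) / (z - z0)) \<longlongrightarrow> D) (at z0)"
      unfolding tendsto_at_iff_sequentially comp_def
    proof (intro allI impI)
      fix X assume X: "\<forall>i. X i \<in> UNIV - {z0}" "X \<longlonglongrightarrow> z0"
      have "eventually (\<lambda>n. X n \<in> ball z0 (r/2)) sequentially"
        by (rule topological_tendstoD[OF X(2)]) (use r in auto)
      then obtain N where N: "\<And>n. n \<ge> N \<Longrightarrow> X n \<in> ball z0 (r/2)"
        by (auto simp: eventually_sequentially)
      have "(\<lambda>n. \<integral>t. (f (X (n+N)) t - f z0 t) / (X (n+N) - z0) \<partial>M) \<longlonglongrightarrow> D"
      proof (rule lim)
        show "X (n+N) \<in> cball z0 (r/2)" for n using N[of "n+N"] by auto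
      qed (use X in \<open>auto intro: LIMSEQ_ignore_initial_segment\<close>)
      also have "(\<lambda>n. \<integral>t. (f (X (n+N)) t - f z0 t) / (X (n+N) - z0) \<partial>M) =
        (\<lambda>n. ((\<integral>t. f (X (n+N)) t \<partial>M) - (\<integral>t. f z0 t \<partial>M)) / (X (n+N) - z0))"
      proof
        fix n
        have "X (n+N) \<in> cball z0 r" using N[of "n+N"] r by auto
        thus "(\<integral>t. (f (X (n+N)) t - f z0 t) / (X (n+N) - z0) \<partial>M) =
          ((\<integral>t. f (X (n+N)) t \<partial>M) - (\<integral>t. f z0 t \<partial>M)) / (X (n+N) - z0)"
          using int[of z0] int[of "X (n+N)"] r by (simp add: Bochner_Integration.integral_diff)
      qed
      finally show "(\<lambda>n. ((\<integral>t. f (X n) t \<partial>M) - (\<integral>t. f z0 t \<partial>M)) / (X n - z0)) \<longlonglongrightarrow> D"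
        by (rule LIMSEQ_offset)
    qed
    thus ?thesis by (auto simp: has_field_derivative_iff)
  qed
  thus ?thesis using S by (auto simp: holomorphic_on_open)
qed

section \<open>The Gamma integral with a complex rate\<close>

abbreviation pos_reals :: "real measure" where "pos_reals \<equiv> lebesgue_on {0<..}"

lemma integrable_lebesgue_on_iff:
  fixes f :: "real \<Rightarrow> 'b::euclidean_space"
  assumes "S \<in> sets lebesgue"
  shows "integrable (lebesgue_on S) f \<longleftrightarrow> f absolutely_integrable_on S"
  using assms by (simp add: integrable_restrict_space set_integrable_def)

lemma integrable_Gamma_kernel:
  assumes "\<alpha> > 0" "c > 0"
  shows "integrable pos_reals (\<lambda>t::real. t powr (\<alpha> - 1) * exp (- c * t))"
proof -
  have "integrable pos_reals (\<lambda>t. complex_of_real t powr (of_real \<alpha> - 1) / of_real (exp (c * t)))"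
    by (subst integrable_lebesgue_on_iff) (use assms absolutely_integrable_Gamma_integral[of "of_real \<alpha>" c] in auto)
  hence "integrable pos_reals (\<lambda>t. norm (complex_of_real t powr (of_real \<alpha> - 1) / of_real (exp (c * t))))"
    by (rule integrable_norm)
  also have "?this \<longleftrightarrow> ?thesis"
    by (intro Bochner_Integration.integrable_cong refl)
       (auto simp: norm_divide norm_powr_real_powr exp_minus divide_inverse norm_inverse norm_mult simp flip: exp_of_real)
  finally show ?thesis .
qed

lemma borel_measurable_pos_reals:
  assumes "continuous_on {0<..} f"
  shows "f \<in> borel_measurable pos_reals"
  by (rule continuous_imp_measurable_on_sets_lebesgue[OF assms]) auto

lemma continuous_on_of_real_powr:
  "continuous_on {0<..} (\<lambda>t. complex_of_real t powr c)"
  by (intro continuous_intros) (auto simp: complex_nonpos_Reals_iff)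

lemma norm_Gamma_kernel:
  assumes "t > 0"
  shows "norm (of_real t powr (s - 1) * exp (- w * of_real t)) = t powr (Re s - 1) * exp (- Re w * t)"
  using assms by (simp add: norm_mult norm_powr_real_powr)

lemma integrable_complex_Gamma_kernel:
  assumes "Re s > 0" "Re w > 0"
  shows "integrable pos_reals (\<lambda>t::real. of_real t powr (s - 1) * exp (- w * of_real t))"
proof (rule Bochner_Integration.integrable_bound[OF integrable_Gamma_kernel[OF assms]])
  show "(\<lambda>t::real. of_real t powr (s - 1) * exp (- w * of_real t)) \<in> borel_measurable pos_reals"
    by (intro borel_measurable_pos_reals continuous_on_mult continuous_on_of_real_powr continuous_intros)
qed (use norm_Gamma_kernel[of _ s w] in \<open>auto intro!: AE_I2 simp del: norm_mult\<close>)

text \<open>The substitution \<open>t \<mapsto> r t\<close> in Euler's integral for \<open>Gamma s\<close>.\<close>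

lemma complex_Gamma_integral_real:
  assumes s: "Re s > 0" and r: "r > 0"
  shows "(\<integral>t. of_real t powr (s - 1) * exp (- of_real r * of_real t) \<partial>pos_reals) =
           Gamma s * of_real r powr (- s)"
proof -
  let ?f = "\<lambda>t::real. of_real t powr (s - 1) / of_real (exp t) :: complex"
  have img: "(\<lambda>t. r * t) ` {0<..} = {0<..}"
  proof (intro equalityI subsetI)
    fix x :: real assume "x \<in> {0<..}"
    thus "x \<in> (\<lambda>t. r * t) ` {0<..}" using r by (intro image_eqI[of _ _ "x / r"]) auto
  qed (use r in auto)
  have "?f absolutely_integrable_on ((\<lambda>t. r * t) ` {0<..}) \<and> integral ((\<lambda>t. r * t) ` {0<..}) ?f = Gamma s"
    unfolding img using absolutely_integrable_Gamma_integral'[OF s] Gamma_integral_complex'[OF s]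
    by (auto simp: integral_unique)
  hence A: "(\<lambda>t. \<bar>r\<bar> *\<^sub>R ?f (r * t)) absolutely_integrable_on {0<..} \<and>
        integral {0<..} (\<lambda>t. \<bar>r\<bar> *\<^sub>R ?f (r * t)) = Gamma s"
    by (subst has_absolute_integral_change_of_variables_real[where g = "\<lambda>t. r * t"])
       (use r in \<open>auto intro!: derivative_eq_intros inj_onI\<close>)
  have "Gamma s = (\<integral>t. \<bar>r\<bar> *\<^sub>R ?f (r * t) \<partial>pos_reals)"
    using A by (subst lebesgue_integral_eq_integral) (auto simp: integrable_lebesgue_on_iff)
  also have "\<dots> = (\<integral>t. of_real r powr s * (of_real t powr (s - 1) * exp (- of_real r * of_real t)) \<partial>pos_reals)"
  proof (rule Bochner_Integration.integral_cong[OF refl])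
    fix t assume "t \<in> space pos_reals"
    hence t: "t > 0" by simp
    have "of_real r powr s = of_real r * (of_real r powr (s - 1) :: complex)"
      using r by (simp add: powr_diff)
    thus "\<bar>r\<bar> *\<^sub>R ?f (r * t) = of_real r powr s * (of_real t powr (s - 1) * exp (- of_real r * of_real t))"
      using r t by (simp add: powr_times_real scaleR_conv_of_real exp_minus divide_inverse exp_of_real[symmetric])
  qed
  also have "\<dots> = of_real r powr s * (\<integral>t. of_real t powr (s - 1) * exp (- of_real r * of_real t) \<partial>pos_reals)"
    by (rule Bochner_Integration.integral_mult_right) (use integrable_complex_Gamma_kernel[of s "of_real r"] s r in auto)
  finally show ?thesis using r by (simp add: powr_minus field_simps)
qed

text \<open>Both sides are holomorphic in \<open>w\<close> on the right half plane and agree for real \<open>w > 0\<close>, so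
  they agree by the identity theorem.\<close>

lemma complex_Gamma_integral:
  assumes s: "Re s > 0" and w: "Re w > 0"
  shows "(\<integral>t. of_real t powr (s - 1) * exp (- w * of_real t) \<partial>pos_reals) = Gamma s * w powr (- s)"
proof -
  define S where "S = {w::complex. Re w > 0}"
  have S: "open S" "connected S"
    unfolding S_def by (auto simp: open_halfspace_Re_gt intro!: convex_connected convex_halfspace_Re_gt)
  define F where "F = (\<lambda>w. (\<integral>t. of_real t powr (s - 1) * exp (- w * of_real t) \<partial>pos_reals) - Gamma s * w powr (- s))"
  have h: "(\<lambda>w. \<integral>t. of_real t powr (s - 1) * exp (- w * of_real t) \<partial>pos_reals) holomorphic_on S"
  proof (rule holomorphic_on_lebesgue_integral[OF S(1)])
    fix w assume "w \<in> S"
    thus "(\<lambda>t. of_real t powr (s - 1) * exp (- w * of_real t)) \<in> borel_measurable pos_reals"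
      using integrable_complex_Gamma_kernel[OF s, of w] by (auto simp: S_def)
  next
    fix w0 assume w0: "w0 \<in> S"
    define c where "c = Re w0 / 2"
    have c: "c > 0" using w0 by (simp add: c_def S_def)
    have Re: "Re z \<ge> c" if "z \<in> cball w0 c" for z
    proof -
      have "\<bar>Re w0 - Re z\<bar> \<le> c" using that abs_Re_le_cmod[of "w0 - z"] by (simp add: dist_norm)
      thus ?thesis unfolding c_def by (simp add: abs_if split: if_splits)
    qed
    show "\<exists>r>0. \<exists>g. integrable pos_reals g \<and> cball w0 r \<subseteq> S \<and>
           (\<forall>z\<in>cball w0 r. \<forall>t\<in>space pos_reals. norm (of_real t powr (s - 1) * exp (- z * of_real t)) \<le> g t)"
    proof (intro exI conjI ballI)
      show "integrable pos_reals (\<lambda>t::real. t powr (Re s - 1) * exp (- c * t))"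
        by (rule integrable_Gamma_kernel[OF s c])
      show "cball w0 c \<subseteq> S" using Re c by (fastforce simp: S_def)
      fix z t assume "z \<in> cball w0 c" "t \<in> space pos_reals"
      thus "norm (of_real t powr (s - 1) * exp (- z * of_real t)) \<le> t powr (Re s - 1) * exp (- c * t)"
        using Re[of z] by (subst norm_Gamma_kernel) auto
    qed (use c in auto)
  qed (auto intro!: holomorphic_intros)
  have "F w = 0"
  proof (rule analytic_continuation[where f = F and S = S and U = "of_real ` {1<..}" and \<xi> = 2])
    show "F holomorphic_on S"
      unfolding F_def by (intro holomorphic_on_diff h holomorphic_intros)
        (auto simp: S_def complex_nonpos_Reals_iff)
    show "(of_real ` {1<..} :: complex set) \<subseteq> S" by (auto simp: S_def)
    have "2 islimpt ({1<..} :: real set)" by (rule interior_limit_point) (simp add: interior_open)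
    hence "(of_real 2 :: complex) islimpt of_real ` {1<..}"
      by (rule islimpt_isCont_image) (auto simp: eventually_at intro!: exI[of _ 1], metis of_real_eq_iff of_real_numeral)
    thus "(2::complex) islimpt of_real ` {1<..}" by simp
    show "F z = 0" if "z \<in> of_real ` {1<..}" for z
      using that complex_Gamma_integral_real[OF s] by (auto simp: F_def)
  qed (use S w in \<open>auto simp: S_def\<close>)
  thus ?thesis by (simp add: F_def)
qed

section \<open>The slit plane\<close>

lemma lerch_slit_plane_iff: "z \<in> lerch_slit_plane \<longleftrightarrow> Im z \<noteq> 0 \<or> Re z < 1"
proof -
  have "z \<in> complex_of_real ` {1..} \<longleftrightarrow> Im z = 0 \<and> Re z \<ge> 1"
    by (auto simp: complex_eq_iff intro!: image_eqI[of _ _ "Re z"])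
  thus ?thesis by (auto simp: lerch_slit_plane_def)
qed

lemma open_lerch_slit_plane: "open lerch_slit_plane"
proof -
  have eq: "lerch_slit_plane = {z. Im z \<noteq> 0 \<or> Re z < 1}" by (auto simp: lerch_slit_plane_iff)
  show ?thesis unfolding eq
    by (intro open_Collect_disj open_Collect_neq open_Collect_less continuous_intros)
qed

text \<open>The slit plane is star-shaped about 0.  This gives its connectedness, and it keeps
  \<open>z * exp (- t)\<close> off the cut for all \<open>t \<ge> 0\<close> in the integral representation below.\<close>

lemma lerch_slit_plane_scale:
  assumes "z \<in> lerch_slit_plane" "0 \<le> u" "u \<le> 1"
  shows "z * of_real u \<in> lerch_slit_plane"
proof (cases "u = 0")
  case False
  have "Re z * u < 1" if "Re z < 1"
  proof (cases "Re z > 0")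
    case True
    hence "Re z * u \<le> Re z * 1" using assms by (intro mult_left_mono) auto
    thus ?thesis using that by simp
  next
    case False
    hence "Re z * u \<le> 0" using assms by (simp add: mult_nonpos_nonneg)
    thus ?thesis by simp
  qed
  thus ?thesis using assms False by (auto simp: lerch_slit_plane_iff)
qed (auto simp: lerch_slit_plane_iff)

lemma starlike_lerch_slit_plane: "starlike lerch_slit_plane"
  unfolding starlike_def
proof (intro bexI[of _ 0] ballI subsetI)
  fix x y assume x: "x \<in> lerch_slit_plane" and "y \<in> closed_segment 0 x"
  then obtain u where "0 \<le> u" "u \<le> 1" "y = u *\<^sub>R x" by (auto simp: in_segment)
  thus "y \<in> lerch_slit_plane"
    using lerch_slit_plane_scale[OF x, of u] by (simp add: scaleR_conv_of_real mult.commute)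
qed (simp add: lerch_slit_plane_iff)

lemma unit_ball_subset_lerch_slit_plane: "ball 0 1 \<subseteq> lerch_slit_plane"
proof
  fix z :: complex assume "z \<in> ball 0 1"
  hence "Re z < 1" using complex_Re_le_cmod[of z] by simp
  thus "z \<in> lerch_slit_plane" by (simp add: lerch_slit_plane_iff)
qed

lemma lerch_slit_plane_eqI:
  assumes "f holomorphic_on lerch_slit_plane" "g holomorphic_on lerch_slit_plane"
    and "\<And>z. z \<in> ball 0 1 \<Longrightarrow> f z = g z" and "z \<in> lerch_slit_plane"
  shows "f z = g z"
  by (rule analytic_continuation_open[of "ball 0 1" lerch_slit_plane f g])
     (use assms open_lerch_slit_plane unit_ball_subset_lerch_slit_plane
        starlike_imp_connected[OF starlike_lerch_slit_plane] in auto)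

section \<open>Continuation of the Lerch series in both variables\<close>

text \<open>The operator \<open>f \<mapsto> y f' + v f\<close> multiplies the \<open>j\<close>-th Taylor coefficient by \<open>j + v\<close> and
  does not leave the domain of holomorphy.\<close>

lemma euler_operator_continuation:
  assumes f: "f holomorphic_on lerch_slit_plane"
    and sums: "\<And>y. y \<in> ball 0 1 \<Longrightarrow> (\<lambda>j. c j * y ^ j) sums f y"
  shows "\<exists>g. g holomorphic_on lerch_slit_plane \<and>
             (\<forall>y\<in>ball 0 1. (\<lambda>j. (of_nat j + v) * c j * y ^ j) sums g y)"
proof (intro exI conjI ballI)
  show "(\<lambda>y. y * deriv f y + v * f y) holomorphic_on lerch_slit_plane"
    using open_lerch_slit_plane f by (intro holomorphic_intros) auto
  fix y :: complex assume y: "y \<in> ball 0 1"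
  have "(f has_field_derivative deriv f y) (at y)"
    using holomorphic_derivI[OF f open_lerch_slit_plane] y unit_ball_subset_lerch_slit_plane by blast
  with sums y have "(\<lambda>n. diffs c n * y ^ n) sums deriv f y"
    by (intro termdiffs_sums_strong[of 1 c f]) auto
  hence "(\<lambda>n. y * (diffs c n * y ^ n)) sums (y * deriv f y)" by (rule sums_mult)
  hence "(\<lambda>n. of_nat (Suc n) * c (Suc n) * y ^ Suc n) sums (y * deriv f y)"
    by (simp add: diffs_def mult_ac)
  hence "(\<lambda>n. of_nat n * c n * y ^ n) sums (y * deriv f y)"
    by (subst (asm) sums_Suc_iff) simp
  from sums_add[OF this sums_mult[OF sums[OF y], of v]]
  show "(\<lambda>j. (of_nat j + v) * c j * y ^ j) sums (y * deriv f y + v * f y)"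
    by (simp add: algebra_simps)
qed

lemma geometric_power_continuation:
  "\<exists>q. q holomorphic_on lerch_slit_plane \<and>
       (\<forall>y\<in>ball 0 1. (\<lambda>j. (of_nat j + v) ^ N * y ^ j) sums q y)"
proof (induction N)
  case 0
  show ?case
  proof (intro exI conjI ballI)
    show "(\<lambda>y. 1 / (1 - y)) holomorphic_on lerch_slit_plane"
      by (intro holomorphic_intros) (auto simp: lerch_slit_plane_iff)
  qed (use geometric_sums in auto)
next
  case (Suc N)
  then obtain q where q: "q holomorphic_on lerch_slit_plane"
    "\<And>y. y \<in> ball 0 1 \<Longrightarrow> (\<lambda>j. (of_nat j + v) ^ N * y ^ j) sums q y" by blast
  show ?case using euler_operator_continuation[OF q, of v] by (simp add: mult_ac)
qed

text \<open>With \<open>q y = (\<Sum>j. (j + v) ^ N * y ^ j)\<close> this is formally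
  \<open>Gamma \<sigma>\<close> times the Lerch series at the exponent \<open>\<sigma> - N\<close>: the integral over each summand
  produces \<open>Gamma \<sigma> * (j + v) powr (- \<sigma>)\<close>, and the factor \<open>(j + v) ^ N\<close> lowers the exponent.
  Since the integral converges for \<open>Re \<sigma> > 0\<close> and \<open>Re v > 0\<close>, it reaches all \<open>s\<close> with \<open>Re s > - N\<close>.\<close>

definition lerch_mellin :: "(complex \<Rightarrow> complex) \<Rightarrow> complex \<Rightarrow> complex \<Rightarrow> complex \<Rightarrow> complex" where
  "lerch_mellin q v z \<sigma> =
     (\<integral>t. of_real t powr (\<sigma> - 1) * exp (- v * of_real t) * q (z * of_real (exp (- t))) \<partial>pos_reals)"

lemma bounded_on_scaled_compact:
  assumes q: "q holomorphic_on lerch_slit_plane" and K: "compact K" "K \<subseteq> lerch_slit_plane"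
  shows "\<exists>B\<ge>0. \<forall>z\<in>K. \<forall>u\<in>{0..1}. norm (q (z * of_real u)) \<le> B"
proof -
  have "compact ((\<lambda>(z,u). q (z * of_real u)) ` (K \<times> {0..1}))"
  proof (rule compact_continuous_image)
    show "continuous_on (K \<times> {0..1}) (\<lambda>(z,u). q (z * of_real u))"
      unfolding case_prod_unfold
      by (rule continuous_on_compose2[OF holomorphic_on_imp_continuous_on[OF q]])
         (use K lerch_slit_plane_scale in \<open>auto intro!: continuous_intros\<close>)
  qed (use K in \<open>auto intro: compact_Times\<close>)
  hence "bounded ((\<lambda>(z,u). q (z * of_real u)) ` (K \<times> {0..1}))" by (rule compact_imp_bounded)
  then obtain B where "B > 0" "\<forall>x\<in>(\<lambda>(z,u). q (z * of_real u)) ` (K \<times> {0..1}). norm x \<le> B"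
    by (auto simp: bounded_pos)
  thus ?thesis by (intro exI[of _ B]) force
qed

lemma measurable_lerch_mellin:
  assumes "q holomorphic_on lerch_slit_plane" "z \<in> lerch_slit_plane"
  shows "(\<lambda>t. of_real t powr (\<sigma> - 1) * exp (- v * of_real t) * q (z * of_real (exp (- t))))
           \<in> borel_measurable pos_reals"
  by (intro borel_measurable_pos_reals continuous_on_mult continuous_on_of_real_powr
        continuous_on_compose2[OF holomorphic_on_imp_continuous_on[OF assms(1)]] continuous_intros)
     (use lerch_slit_plane_scale[OF assms(2)] in \<open>auto simp del: of_real_exp\<close>)

lemma lerch_mellin_holomorphic_z:
  assumes q: "q holomorphic_on lerch_slit_plane" and v: "Re v > 0" and \<sigma>: "Re \<sigma> > 0"
  shows "(\<lambda>z. lerch_mellin q v z \<sigma>) holomorphic_on lerch_slit_plane"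
  unfolding lerch_mellin_def
proof (rule holomorphic_on_lebesgue_integral[OF open_lerch_slit_plane])
  fix t assume t: "t \<in> space pos_reals"
  have "(\<lambda>z. q (z * of_real (exp (- t)))) holomorphic_on lerch_slit_plane"
    by (rule holomorphic_on_compose_gen[OF _ q, unfolded o_def])
       (use t in \<open>auto intro!: holomorphic_intros lerch_slit_plane_scale simp del: of_real_exp\<close>)
  thus "(\<lambda>z. of_real t powr (\<sigma> - 1) * exp (- v * of_real t) * q (z * of_real (exp (- t))))
          holomorphic_on lerch_slit_plane"
    by (intro holomorphic_intros)
next
  fix z0 assume "z0 \<in> lerch_slit_plane"
  then obtain r where r: "r > 0" "cball z0 r \<subseteq> lerch_slit_plane"
    using open_lerch_slit_plane open_contains_cball by blast
  obtain B where B: "\<And>z u. z \<in> cball z0 r \<Longrightarrow> u \<in> {0..1} \<Longrightarrow> norm (q (z * of_real u)) \<le> B"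
    using bounded_on_scaled_compact[OF q compact_cball r(2)] by blast
  show "\<exists>r>0. \<exists>g. integrable pos_reals g \<and> cball z0 r \<subseteq> lerch_slit_plane \<and>
     (\<forall>z\<in>cball z0 r. \<forall>t\<in>space pos_reals. norm (of_real t powr (\<sigma> - 1) *
         exp (- v * of_real t) * q (z * of_real (exp (- t)))) \<le> g t)"
  proof (intro exI conjI ballI)
    show "integrable pos_reals (\<lambda>t::real. t powr (Re \<sigma> - 1) * exp (- Re v * t) * B)"
      using integrable_Gamma_kernel[OF \<sigma> v] by simp
    fix z t assume z: "z \<in> cball z0 r" and t: "t \<in> space pos_reals"
    have "norm (q (z * of_real (exp (- t)))) \<le> B" using z t by (intro B) auto
    thus "norm (of_real t powr (\<sigma> - 1) * exp (- v * of_real t) * q (z * of_real (exp (- t)))) \<le>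
            t powr (Re \<sigma> - 1) * exp (- Re v * t) * B"
      using t by (subst norm_mult, subst norm_Gamma_kernel) (auto intro!: mult_left_mono)
  qed (use r in auto)
qed (rule measurable_lerch_mellin[OF q])

text \<open>Near an exponent \<open>\<sigma>0\<close>, with \<open>a = Re \<sigma>0 / 2\<close>, the kernel is dominated by the sum of the
  kernels at the exponents \<open>a\<close> and \<open>3 * a\<close>: one controls \<open>t \<le> 1\<close>, the other \<open>t \<ge> 1\<close>.\<close>

lemma lerch_mellin_holomorphic_exponent:
  assumes q: "q holomorphic_on lerch_slit_plane" and v: "Re v > 0" and z: "z \<in> lerch_slit_plane"
  shows "(\<lambda>\<sigma>. lerch_mellin q v z \<sigma>) holomorphic_on {\<sigma>. Re \<sigma> > 0}"
  unfolding lerch_mellin_def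
proof (rule holomorphic_on_lebesgue_integral[OF open_halfspace_Re_gt])
  fix t assume "t \<in> space pos_reals"
  thus "(\<lambda>\<sigma>. of_real t powr (\<sigma> - 1) * exp (- v * of_real t) * q (z * of_real (exp (- t))))
          holomorphic_on {\<sigma>. Re \<sigma> > 0}"
    by (intro holomorphic_intros) auto
next
  fix \<sigma>0 assume \<sigma>0: "\<sigma>0 \<in> {\<sigma>. Re \<sigma> > 0}"
  define a where "a = Re \<sigma>0 / 2"
  have a: "a > 0" using \<sigma>0 by (simp add: a_def)
  have Re: "a \<le> Re \<sigma> \<and> Re \<sigma> \<le> 3 * a" if "\<sigma> \<in> cball \<sigma>0 a" for \<sigma>
  proof -
    have "\<bar>Re \<sigma>0 - Re \<sigma>\<bar> \<le> a" using that abs_Re_le_cmod[of "\<sigma>0 - \<sigma>"] by (simp add: dist_norm)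
    thus ?thesis unfolding a_def by (simp add: abs_if split: if_splits)
  qed
  obtain B where B: "\<And>u. u \<in> {0..1} \<Longrightarrow> norm (q (z * of_real u)) \<le> B"
    using bounded_on_scaled_compact[OF q, of "{z}"] z by fastforce
  show "\<exists>r>0. \<exists>g. integrable pos_reals g \<and> cball \<sigma>0 r \<subseteq> {\<sigma>. Re \<sigma> > 0} \<and>
     (\<forall>\<sigma>\<in>cball \<sigma>0 r. \<forall>t\<in>space pos_reals. norm (of_real t powr (\<sigma> - 1) *
         exp (- v * of_real t) * q (z * of_real (exp (- t)))) \<le> g t)"
  proof (intro exI conjI ballI)
    show "integrable pos_reals (\<lambda>t::real. (t powr (a - 1) * exp (- Re v * t) +
             t powr (3 * a - 1) * exp (- Re v * t)) * B)"
      using integrable_Gamma_kernel[OF a v] integrable_Gamma_kernel[of "3 * a", OF _ v] a by simp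
    show "cball \<sigma>0 a \<subseteq> {\<sigma>. Re \<sigma> > 0}" using Re a by fastforce
    fix \<sigma> t assume \<sigma>: "\<sigma> \<in> cball \<sigma>0 a" and t: "t \<in> space pos_reals"
    have "norm (q (z * of_real (exp (- t)))) \<le> B" using t by (intro B) auto
    moreover have "t powr (Re \<sigma> - 1) \<le> t powr (a - 1) + t powr (3 * a - 1)"
    proof (cases "t \<ge> 1")
      case True
      hence "t powr (Re \<sigma> - 1) \<le> t powr (3 * a - 1)" using Re[OF \<sigma>] by (intro powr_mono) auto
      thus ?thesis by (simp add: add_increasing)
    next
      case False
      hence "t powr (Re \<sigma> - 1) \<le> t powr (a - 1)" using Re[OF \<sigma>] t by (intro powr_mono') auto
      thus ?thesis by (simp add: add_increasing2)
    qed
    hence "t powr (Re \<sigma> - 1) * exp (- Re v * t) \<le>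
             t powr (a - 1) * exp (- Re v * t) + t powr (3 * a - 1) * exp (- Re v * t)"
      unfolding distrib_right[symmetric] by (intro mult_right_mono) auto
    ultimately show "norm (of_real t powr (\<sigma> - 1) * exp (- v * of_real t) * q (z * of_real (exp (- t)))) \<le>
            (t powr (a - 1) * exp (- Re v * t) + t powr (3 * a - 1) * exp (- Re v * t)) * B"
      using t by (subst norm_mult, subst norm_Gamma_kernel) (auto intro!: mult_mono)
  qed (use a in auto)
qed (rule measurable_lerch_mellin[OF q z])

text \<open>Termwise integration, by dominated convergence of the partial sums:
  \<open>\<bar>z * exp (- t)\<bar> \<le> \<bar>z\<bar>\<close>, so all of them are bounded by the absolutely convergent series
  at \<open>z\<close>.\<close>

lemma lerch_mellin_sums:
  assumes q: "q holomorphic_on lerch_slit_plane"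
    and sums: "\<And>y. y \<in> ball 0 1 \<Longrightarrow> (\<lambda>j. c j * y ^ j) sums q y"
    and v: "Re v > 0" and \<sigma>: "Re \<sigma> > 0" and z: "norm z < 1"
  shows "(\<lambda>j. c j * z ^ j * (Gamma \<sigma> * (of_nat j + v) powr (-\<sigma>))) sums lerch_mellin q v z \<sigma>"
proof -
  let ?k = "\<lambda>w t. of_real t powr (\<sigma> - 1) * exp (- w * of_real t) :: complex"
  let ?S = "\<lambda>n t. \<Sum>j<n. c j * z ^ j * ?k (of_nat j + v) t"
  obtain \<rho> where \<rho>: "norm z < \<rho>" "\<rho> < 1" using dense[OF z] by blast
  have "summable (\<lambda>j. c j * (of_real \<rho>) ^ j)"
    using sums[of "of_real \<rho>"] \<rho> le_less_trans[OF norm_ge_zero \<rho>(1)] by (auto simp: sums_iff)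
  hence summ: "summable (\<lambda>j. norm (c j * z ^ j))"
    by (rule powser_insidea) (use \<rho> in auto)
  define B where "B = (\<Sum>j. norm (c j * z ^ j))"
  have Re: "Re (of_nat j + v) > 0" for j using v by (simp add: add_nonneg_pos)
  have key: "?S n t = ?k v t * (\<Sum>j<n. c j * (z * of_real (exp (- t))) ^ j)" for n t
  proof -
    have "exp (- (of_nat j + v) * of_real t) = exp (- v * of_real t) * of_real (exp (- t)) ^ j" for j
      by (simp add: exp_of_nat_mult[symmetric] exp_of_real[symmetric] exp_add[symmetric] algebra_simps)
    thus ?thesis by (simp add: sum_distrib_left power_mult_distrib mult_ac)
  qed
  have "(\<lambda>n. \<integral>t. ?S n t \<partial>pos_reals) \<longlonglongrightarrow> lerch_mellin q v z \<sigma>"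
    unfolding lerch_mellin_def
  proof (rule integral_dominated_convergence)
    show "(\<lambda>t. ?k v t * q (z * of_real (exp (- t)))) \<in> borel_measurable pos_reals"
      by (rule measurable_lerch_mellin[OF q]) (use z unit_ball_subset_lerch_slit_plane in auto)
    show "?S n \<in> borel_measurable pos_reals" for n
      by (intro borel_measurable_sum borel_measurable_times borel_measurable_const
            borel_measurable_integrable integrable_complex_Gamma_kernel \<sigma> Re)
    show "integrable pos_reals (\<lambda>t::real. t powr (Re \<sigma> - 1) * exp (- Re v * t) * B)"
      using integrable_Gamma_kernel[OF \<sigma> v] by simp
    have small: "norm (z * of_real (exp (- t))) \<le> norm z" if "t > 0" for t
      using that by (simp add: norm_mult mult_left_le)
    show "AE t in pos_reals. (\<lambda>n. ?S n t) \<longlonglongrightarrow> ?k v t * q (z * of_real (exp (- t)))"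
    proof (rule AE_I2)
      fix t assume "t \<in> space pos_reals"
      hence "z * of_real (exp (- t)) \<in> ball 0 1" using small[of t] z by simp
      thus "(\<lambda>n. ?S n t) \<longlonglongrightarrow> ?k v t * q (z * of_real (exp (- t)))"
        unfolding key using sums by (intro tendsto_mult tendsto_const) (simp add: sums_def)
    qed
    show "AE t in pos_reals. norm (?S n t) \<le> t powr (Re \<sigma> - 1) * exp (- Re v * t) * B" for n
    proof (rule AE_I2)
      fix t assume "t \<in> space pos_reals"
      hence t: "t > 0" by simp
      have "norm (\<Sum>j<n. c j * (z * of_real (exp (- t))) ^ j) \<le> (\<Sum>j<n. norm (c j * z ^ j))"
        using small[OF t] by (intro sum_norm_le) (auto simp: norm_mult norm_power intro!: mult_left_mono power_mono)
      also have "\<dots> \<le> B"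
        unfolding B_def by (intro sum_le_suminf summ) auto
      finally show "norm (?S n t) \<le> t powr (Re \<sigma> - 1) * exp (- Re v * t) * B"
        unfolding key using t by (subst norm_mult, subst norm_Gamma_kernel) (auto intro!: mult_left_mono)
    qed
  qed
  also have "(\<lambda>n. \<integral>t. ?S n t \<partial>pos_reals) =
      (\<lambda>n. \<Sum>j<n. c j * z ^ j * (Gamma \<sigma> * (of_nat j + v) powr (-\<sigma>)))"
  proof
    fix n
    have "(\<integral>t. ?S n t \<partial>pos_reals) = (\<Sum>j<n. \<integral>t. c j * z ^ j * ?k (of_nat j + v) t \<partial>pos_reals)"
      by (rule Bochner_Integration.integral_sum) (intro integrable_mult_right integrable_complex_Gamma_kernel \<sigma> Re)
    also have "\<dots> = (\<Sum>j<n. c j * z ^ j * (Gamma \<sigma> * (of_nat j + v) powr (-\<sigma>)))"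
      using complex_Gamma_integral[OF \<sigma> Re] integrable_complex_Gamma_kernel[OF \<sigma> Re]
      by (simp only: integral_mult_right_zero)
    finally show "(\<integral>t. ?S n t \<partial>pos_reals) = (\<Sum>j<n. c j * z ^ j * (Gamma \<sigma> * (of_nat j + v) powr (-\<sigma>)))" .
  qed
  finally show ?thesis by (simp add: sums_def)
qed

lemma lerch_continuation_half_plane:
  assumes v: "Re v > 0"
  shows "\<exists>A. (\<forall>s. Re s > - real N \<longrightarrow> (\<lambda>z. A z s) holomorphic_on lerch_slit_plane) \<and>
             (\<forall>z\<in>lerch_slit_plane. A z holomorphic_on {s. Re s > - real N}) \<and>
             (\<forall>z\<in>ball 0 1. \<forall>s. Re s > - real N \<longrightarrow> (\<lambda>j. z ^ j * (of_nat j + v) powr (-s)) sums A z s)"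
proof -
  obtain q where q: "q holomorphic_on lerch_slit_plane"
    "\<And>y. y \<in> ball 0 1 \<Longrightarrow> (\<lambda>j. (of_nat j + v) ^ N * y ^ j) sums q y"
    using geometric_power_continuation by blast
  define A where "A = (\<lambda>z s. rGamma (s + of_nat N) * lerch_mellin q v z (s + of_nat N))"
  show ?thesis
  proof (intro exI[of _ A] conjI allI impI ballI)
    fix s assume "Re s > - real N"
    thus "(\<lambda>z. A z s) holomorphic_on lerch_slit_plane"
      unfolding A_def by (intro holomorphic_intros lerch_mellin_holomorphic_z q v) auto
  next
    fix z assume z: "z \<in> lerch_slit_plane"
    have "(\<lambda>s. lerch_mellin q v z (s + of_nat N)) holomorphic_on {s. Re s > - real N}"
      by (rule holomorphic_on_compose_gen[OF _ lerch_mellin_holomorphic_exponent[OF q(1) v z], unfolded o_def])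
         (auto intro!: holomorphic_intros)
    thus "A z holomorphic_on {s. Re s > - real N}"
      unfolding A_def by (intro holomorphic_intros)
  next
    fix z s assume z: "z \<in> ball (0::complex) 1" and s: "Re s > - real N"
    define \<sigma> where "\<sigma> = s + of_nat N"
    have \<sigma>: "Re \<sigma> > 0" using s by (simp add: \<sigma>_def)
    have nz: "of_nat j + v \<noteq> 0" for j
      using v by (auto simp: complex_eq_iff)
    have "Gamma \<sigma> \<noteq> 0" using \<sigma> by (auto simp: Gamma_eq_zero_iff elim!: nonpos_Ints_cases)
    hence G: "rGamma \<sigma> * (Gamma \<sigma> * x) = x" for x
      by (simp add: rGamma_inverse_Gamma)
    have "(\<lambda>j. rGamma \<sigma> * ((of_nat j + v) ^ N * z ^ j * (Gamma \<sigma> * (of_nat j + v) powr (-\<sigma>)))) sums A z s"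
      unfolding A_def \<sigma>_def[symmetric] using z
      by (intro sums_mult lerch_mellin_sums[OF q v \<sigma>]) auto
    also have "(\<lambda>j. rGamma \<sigma> * ((of_nat j + v) ^ N * z ^ j * (Gamma \<sigma> * (of_nat j + v) powr (-\<sigma>)))) =
        (\<lambda>j. z ^ j * (of_nat j + v) powr (-s))"
    proof
      fix j
      have "(of_nat j + v) powr (-s) = (of_nat j + v) powr (of_nat N) * (of_nat j + v) powr (-\<sigma>)"
        unfolding powr_add[symmetric] by (simp add: \<sigma>_def)
      also have "(of_nat j + v) powr (of_nat N) = (of_nat j + v) ^ N"
        using nz by (simp add: powr_nat)
      finally show "rGamma \<sigma> * ((of_nat j + v) ^ N * z ^ j * (Gamma \<sigma> * (of_nat j + v) powr (-\<sigma>))) =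
        z ^ j * (of_nat j + v) powr (-s)" using G by (simp add: mult_ac)
    qed
    finally show "(\<lambda>j. z ^ j * (of_nat j + v) powr (-s)) sums A z s" .
  qed
qed

text \<open>The joint continuation of the Lerch series: to the slit plane in \<open>z\<close> and to the whole plane in
  \<open>s\<close>.  Holomorphy in \<open>s\<close> at points \<open>z\<close> of the unit circle is what links the continuation in
  \<open>z\<close> to the Hurwitz zeta function, which is a continuation in \<open>s\<close>.\<close>

definition is_lerch_continuation :: "complex \<Rightarrow> (complex \<Rightarrow> complex \<Rightarrow> complex) \<Rightarrow> bool" where
  "is_lerch_continuation v F \<longleftrightarrow>
     (\<forall>s. (\<lambda>z. F z s) holomorphic_on lerch_slit_plane) \<and>
     (\<forall>z\<in>lerch_slit_plane. F z holomorphic_on UNIV) \<and>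
     (\<forall>z\<in>ball 0 1. \<forall>s. (\<lambda>j. z ^ j * (of_nat j + v) powr (-s)) sums F z s)"

text \<open>The functions on the half planes \<open>Re s > - N\<close> fit together, because for fixed \<open>s\<close> each of them
  is the unique continuation of the same power series in \<open>z\<close>.\<close>

lemma is_lerch_continuation_exists_Re_pos:
  assumes v: "Re v > 0"
  shows "\<exists>F. is_lerch_continuation v F"
proof -
  have "\<forall>N. \<exists>A. (\<forall>s. Re s > - real N \<longrightarrow> (\<lambda>z. A z s) holomorphic_on lerch_slit_plane) \<and>
             (\<forall>z\<in>lerch_slit_plane. A z holomorphic_on {s. Re s > - real N}) \<and>
             (\<forall>z\<in>ball 0 1. \<forall>s. Re s > - real N \<longrightarrow> (\<lambda>j. z ^ j * (of_nat j + v) powr (-s)) sums A z s)"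
    using lerch_continuation_half_plane[OF v] by (rule allI)
  from choice[OF this] obtain A where
    A1: "\<And>N s. Re s > - real N \<Longrightarrow> (\<lambda>z. A N z s) holomorphic_on lerch_slit_plane" and
    A2: "\<And>N z. z \<in> lerch_slit_plane \<Longrightarrow> A N z holomorphic_on {s. Re s > - real N}" and
    A3: "\<And>N z s. z \<in> ball 0 1 \<Longrightarrow> Re s > - real N \<Longrightarrow> (\<lambda>j. z ^ j * (of_nat j + v) powr (-s)) sums A N z s"
    by blast
  \<comment> \<open>Some index whose half plane contains \<open>s\<close>.\<close>
  define M where "M = (\<lambda>s. nat \<lceil>\<bar>Re s\<bar>\<rceil> + 1)"
  have M: "Re s > - real (M s)" for s unfolding M_def by linarith
  define F where "F = (\<lambda>z s. A (M s) z s)"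
  have eq: "F z s = A N z s" if "Re s > - real N" "z \<in> lerch_slit_plane" for z s N
    unfolding F_def
  proof (rule lerch_slit_plane_eqI[OF A1 A1])
    show "A (M s) y s = A N y s" if y: "y \<in> ball 0 1" for y
      using A3[OF y M[of s]] A3[OF y \<open>Re s > - real N\<close>] by (rule sums_unique2)
  qed (use that M in auto)
  have "is_lerch_continuation v F"
    unfolding is_lerch_continuation_def
  proof (intro conjI ballI allI)
    show "(\<lambda>z. F z s) holomorphic_on lerch_slit_plane" for s
      unfolding F_def by (rule A1[OF M])
    show "(\<lambda>j. z ^ j * (of_nat j + v) powr (-s)) sums F z s" if "z \<in> ball 0 1" for z s
      unfolding F_def by (rule A3[OF that M])
    fix z assume z: "z \<in> lerch_slit_plane"
    have "F z holomorphic_on (\<Union>N. {s. Re s > - real N})"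
    proof (rule holomorphic_on_UN_open)
      fix N
      show "F z holomorphic_on {s. Re s > - real N}"
        using A2[OF z, of N] eq[OF _ z] by (metis (mono_tags, lifting) holomorphic_transform mem_Collect_eq)
    qed (rule open_halfspace_Re_gt)
    also have "(\<Union>N. {s. Re s > - real N}) = UNIV" using M by auto
    finally show "F z holomorphic_on UNIV" .
  qed
  thus ?thesis by blast
qed

lemma of_nat_add_nonzero:
  fixes v :: complex
  assumes "v \<notin> \<int>\<^sub>\<le>\<^sub>0" shows "of_nat j + v \<noteq> 0"
proof
  assume "of_nat j + v = 0"
  hence "v = - of_nat j" by (simp add: eq_neg_iff_add_eq_0 add.commute)
  thus False using assms by (simp add: minus_of_nat_in_nonpos_Ints)
qed

text \<open>The relation \<open>\<Phi>(z, s, v) = v powr (- s) + z * \<Phi>(z, s, v + 1)\<close> carries the continuation from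
  the right half plane of \<open>v\<close> to the left, one unit strip at a time.\<close>

lemma is_lerch_continuation_exists:
  assumes v: "v \<notin> \<int>\<^sub>\<le>\<^sub>0"
  shows "\<exists>F. is_lerch_continuation v F"
proof -
  have "\<exists>F. is_lerch_continuation v F" if "Re v > - real n" "v \<notin> \<int>\<^sub>\<le>\<^sub>0" for n
    using that
  proof (induction n arbitrary: v)
    case 0
    thus ?case using is_lerch_continuation_exists_Re_pos by simp
  next
    case (Suc n)
    have "v + 1 \<notin> \<int>\<^sub>\<le>\<^sub>0"
    proof
      assume "v + 1 \<in> \<int>\<^sub>\<le>\<^sub>0"
      then obtain i :: int where "v + 1 = of_int i" "i \<le> 0" by (elim nonpos_Ints_cases)
      hence "v = of_int (i - 1)" "i - 1 \<le> 0" by (auto simp: algebra_simps)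
      thus False using Suc.prems(2) nonpos_Ints_of_int by blast
    qed
    with Suc obtain F where F: "is_lerch_continuation (v + 1) F" by force
    define G where "G = (\<lambda>z s. v powr (-s) + z * F z s)"
    have v0: "v \<noteq> 0" using Suc.prems(2) by auto
    have "is_lerch_continuation v G"
      unfolding is_lerch_continuation_def
    proof (intro conjI allI ballI)
      show "(\<lambda>z. G z s) holomorphic_on lerch_slit_plane" for s
        using F unfolding G_def is_lerch_continuation_def by (auto intro!: holomorphic_intros)
      show "G z holomorphic_on UNIV" if "z \<in> lerch_slit_plane" for z
        using F v0 that unfolding G_def is_lerch_continuation_def by (auto intro!: holomorphic_intros)
      fix z s assume "z \<in> ball (0::complex) 1"
      hence "(\<lambda>j. z ^ j * (of_nat j + (v + 1)) powr (-s)) sums F z s"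
        using F by (auto simp: is_lerch_continuation_def)
      hence "(\<lambda>j. z * (z ^ j * (of_nat j + (v + 1)) powr (-s))) sums (z * F z s)"
        by (rule sums_mult)
      also have "(\<lambda>j. z * (z ^ j * (of_nat j + (v + 1)) powr (-s))) =
          (\<lambda>j. z ^ Suc j * (of_nat (Suc j) + v) powr (-s))"
        by (simp add: algebra_simps)
      finally show "(\<lambda>j. z ^ j * (of_nat j + v) powr (-s)) sums G z s"
        by (subst (asm) sums_Suc_iff) (simp add: G_def add.commute)
    qed
    thus ?case by blast
  qed
  moreover obtain n where "- Re v < real n" using reals_Archimedean2 by blast
  ultimately show ?thesis using v by (metis minus_less_iff)
qed

text \<open>The parameters are ordered so that the partial application \<open>lerch_extension v\<close> is the joint
  continuation.\<close>

definition lerch_extension :: "complex \<Rightarrow> complex \<Rightarrow> complex \<Rightarrow> complex" where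
  "lerch_extension v = (SOME F. is_lerch_continuation v F)"

lemma is_lerch_continuation_lerch_extension:
  "v \<notin> \<int>\<^sub>\<le>\<^sub>0 \<Longrightarrow> is_lerch_continuation v (lerch_extension v)"
  unfolding lerch_extension_def using is_lerch_continuation_exists by (rule someI_ex)

lemmas lerch_extension_holomorphic_z =
    is_lerch_continuation_lerch_extension[unfolded is_lerch_continuation_def, THEN conjunct1, rule_format]
  and lerch_extension_holomorphic_s =
    is_lerch_continuation_lerch_extension[unfolded is_lerch_continuation_def, THEN conjunct2, THEN conjunct1, rule_format]
  and lerch_extension_sums =
    is_lerch_continuation_lerch_extension[unfolded is_lerch_continuation_def, THEN conjunct2, THEN conjunct2, rule_format]

lemma lerch_series_altdef: "lerch_series z s v = (\<Sum>j. z ^ j * (of_nat j + v) powr (-s))"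
  by (simp add: lerch_series_def powr_minus field_simps)

lemma lerch_continuation_eq:
  assumes v: "v \<notin> \<int>\<^sub>\<le>\<^sub>0" and z: "z \<in> lerch_slit_plane"
  shows "lerch_continuation s v z = lerch_extension v z s"
proof -
  let ?P = "\<lambda>f. f holomorphic_on lerch_slit_plane \<and> (\<forall>z\<in>ball 0 1. f z = lerch_series z s v)"
  have ser: "lerch_extension v z s = lerch_series z s v" if "z \<in> ball 0 1" for z
    using lerch_extension_sums[OF v that, of s] by (simp add: lerch_series_altdef sums_iff)
  hence "?P (\<lambda>z. lerch_extension v z s)"
    using lerch_extension_holomorphic_z[OF v] by blast
  hence P: "?P (lerch_continuation s v)"
    unfolding lerch_continuation_def by (rule someI[of ?P])
  show ?thesis
    by (rule lerch_slit_plane_eqI[OF _ lerch_extension_holomorphic_z[OF v] _ z]) (use P ser in auto)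
qed

section \<open>Convergence of the series on the unit circle\<close>

lemma holomorphic_on_suminf:
  fixes f :: "nat \<Rightarrow> complex \<Rightarrow> complex"
  assumes S: "open S" and hol: "\<And>n. f n holomorphic_on S"
    and dom: "\<And>z0. z0 \<in> S \<Longrightarrow> \<exists>d>0. \<exists>M. summable M \<and> cball z0 d \<subseteq> S \<and>
                 (\<forall>\<^sub>F n in sequentially. \<forall>z\<in>cball z0 d. norm (f n z) \<le> M n)"
  shows "(\<lambda>z. \<Sum>n. f n z) holomorphic_on S"
proof (rule holomorphic_uniform_sequence[OF S])
  show "(\<lambda>z. \<Sum>i<n. f i z) holomorphic_on S" for n
    by (intro holomorphic_on_sum hol)
  fix z0 assume "z0 \<in> S"
  from dom[OF this] obtain d M where d: "d > 0" "summable M" "cball z0 d \<subseteq> S"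
    "\<forall>\<^sub>F n in sequentially. \<forall>z\<in>cball z0 d. norm (f n z) \<le> M n" by blast
  thus "\<exists>d>0. cball z0 d \<subseteq> S \<and>
          uniform_limit (cball z0 d) (\<lambda>n z. \<Sum>i<n. f i z) (\<lambda>z. \<Sum>n. f n z) sequentially"
    by (intro exI[of _ d] conjI Weierstrass_m_test_ev) auto
qed

lemma norm_powr_minus_le:
  assumes "Re w \<ge> r" "r \<ge> 1" "0 \<le> \<tau>" "\<tau> \<le> Re s"
  shows "norm (w powr (- s)) \<le> exp (pi * \<bar>Im s\<bar>) * r powr (- \<tau>)"
proof -
  have w: "norm w \<ge> r" "w \<noteq> 0" using complex_Re_le_cmod[of w] assms by auto
  have "norm (w powr (- s)) = norm w powr (- Re s) * exp (Im s * Arg w)"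
    using w by (simp add: norm_powr_complex)
  also have "\<dots> \<le> r powr (- \<tau>) * exp (pi * \<bar>Im s\<bar>)"
  proof (intro mult_mono)
    have "norm w powr (- Re s) \<le> norm w powr (- \<tau>)" using w assms by (intro powr_mono) auto
    also have "\<dots> \<le> r powr (- \<tau>)" using w assms by (intro powr_mono2') auto
    finally show "norm w powr (- Re s) \<le> r powr (- \<tau>)" .
    have "Im s * Arg w \<le> \<bar>Im s\<bar> * \<bar>Arg w\<bar>" by (simp flip: abs_mult)
    also have "\<dots> \<le> \<bar>Im s\<bar> * pi"
      using Arg_bounded[of w] by (intro mult_left_mono) auto
    finally show "exp (Im s * Arg w) \<le> exp (pi * \<bar>Im s\<bar>)" by (simp add: mult.commute)
  qed auto
  finally show ?thesis by (simp add: mult.commute)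
qed

text \<open>Replacing \<open>Re (j + v)\<close> by \<open>j / 2\<close> makes the majorants of all series below independent of \<open>v\<close>.\<close>

lemma eventually_Re_shift_ge:
  "\<forall>\<^sub>F j in sequentially. Re (of_nat j + v) \<ge> real j / 2 \<and> real j / 2 \<ge> 1"
proof -
  have "\<forall>\<^sub>F j in sequentially. j \<ge> nat \<lceil>2 * \<bar>Re v\<bar>\<rceil> + 2" by (rule eventually_ge_at_top)
  thus ?thesis
  proof eventually_elim
    case (elim j)
    hence "real j \<ge> 2 * \<bar>Re v\<bar> + 2" by linarith
    thus ?case by (auto simp: abs_if field_simps split: if_splits)
  qed
qed

lemma summable_half_powr: "\<tau> > 1 \<Longrightarrow> summable (\<lambda>j. C * (real j / 2) powr (- \<tau>))"
  by (intro summable_mult) (simp add: powr_divide summable_divide summable_real_powr_iff)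

lemma summable_norm_lerch:
  assumes s: "Re s > 1" and z: "norm z \<le> 1"
  shows "summable (\<lambda>j. norm (z ^ j * (of_nat j + v) powr (- s)))"
proof (rule summable_comparison_test_ev[OF _ summable_half_powr[OF s, of "exp (pi * \<bar>Im s\<bar>)"]])
  show "\<forall>\<^sub>F j in sequentially. norm (norm (z ^ j * (of_nat j + v) powr (- s))) \<le>
          exp (pi * \<bar>Im s\<bar>) * (real j / 2) powr (- Re s)"
    using eventually_Re_shift_ge[of v]
  proof eventually_elim
    case (elim j)
    hence "norm ((of_nat j + v) powr (- s)) \<le> exp (pi * \<bar>Im s\<bar>) * (real j / 2) powr (- Re s)"
      using s by (intro norm_powr_minus_le) auto
    hence "norm (z ^ j) * norm ((of_nat j + v) powr (- s)) \<le> 1 * (exp (pi * \<bar>Im s\<bar>) * (real j / 2) powr (- Re s))"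
      using z by (intro mult_mono) (auto simp: norm_power power_le_one)
    thus ?case by (simp add: norm_mult)
  qed
qed

abbreviation hurwitz_series :: "complex \<Rightarrow> complex \<Rightarrow> complex" where
  "hurwitz_series v s \<equiv> (\<Sum>j. (of_nat j + v) powr (- s))"

lemma hurwitz_series_sums:
  assumes "Re s > 1"
  shows "(\<lambda>j. (of_nat j + v) powr (- s)) sums hurwitz_series v s"
  using summable_norm_cancel[OF summable_norm_lerch[OF assms, of 1 v]] by (simp add: summable_sums)

text \<open>The local data for the majorants: on a small disc \<open>Re s\<close> stays away from \<open>c\<close>, and \<open>Im s\<close> is
  bounded, which bounds the factor \<open>exp (pi * \<bar>Im s\<bar>)\<close> of a complex power.\<close>

lemma local_half_plane:
  assumes "Re s0 > c"
  obtains d \<tau> where "d > 0" "\<tau> > c" "\<And>s. s \<in> cball s0 d \<Longrightarrow> Re s \<ge> \<tau>"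
    "\<And>s. s \<in> cball s0 d \<Longrightarrow> \<bar>Im s\<bar> \<le> \<bar>Im s0\<bar> + d"
proof (rule that[of "(Re s0 - c) / 2" "(Re s0 + c) / 2"])
  fix s assume "s \<in> cball s0 ((Re s0 - c) / 2)"
  hence "norm (s0 - s) \<le> (Re s0 - c) / 2" by (simp add: dist_norm)
  hence "\<bar>Re s0 - Re s\<bar> \<le> (Re s0 - c) / 2" "\<bar>Im s0 - Im s\<bar> \<le> (Re s0 - c) / 2"
    using abs_Re_le_cmod[of "s0 - s"] abs_Im_le_cmod[of "s0 - s"] by auto
  thus "Re s \<ge> (Re s0 + c) / 2" "\<bar>Im s\<bar> \<le> \<bar>Im s0\<bar> + (Re s0 - c) / 2"
    by (auto simp: field_simps abs_if split: if_splits)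
qed (use assms in auto)

lemma hurwitz_series_holomorphic:
  assumes v: "v \<notin> \<int>\<^sub>\<le>\<^sub>0"
  shows "hurwitz_series v holomorphic_on {s. Re s > 1}"
proof (rule holomorphic_on_suminf[OF open_halfspace_Re_gt])
  show "(\<lambda>s. (of_nat j + v) powr (- s)) holomorphic_on {s. Re s > 1}" for j
    using of_nat_add_nonzero[OF v, of j] by (intro holomorphic_intros)
  fix s0 assume "s0 \<in> {s. Re s > 1}"
  then obtain d \<tau> where d: "d > 0" "\<tau> > 1" "\<And>s. s \<in> cball s0 d \<Longrightarrow> Re s \<ge> \<tau>"
    "\<And>s. s \<in> cball s0 d \<Longrightarrow> \<bar>Im s\<bar> \<le> \<bar>Im s0\<bar> + d"
    using local_half_plane[of 1 s0] by auto
  define C where "C = exp (pi * (\<bar>Im s0\<bar> + d))"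
  show "\<exists>d>0. \<exists>M. summable M \<and> cball s0 d \<subseteq> {s. Re s > 1} \<and>
          (\<forall>\<^sub>F j in sequentially. \<forall>s\<in>cball s0 d. norm ((of_nat j + v) powr (- s)) \<le> M j)"
  proof (intro exI conjI)
    show "summable (\<lambda>j. C * (real j / 2) powr (- \<tau>))" by (rule summable_half_powr[OF d(2)])
    show "cball s0 d \<subseteq> {s. Re s > 1}" using d by fastforce
    show "\<forall>\<^sub>F j in sequentially. \<forall>s\<in>cball s0 d. norm ((of_nat j + v) powr (- s)) \<le> C * (real j / 2) powr (- \<tau>)"
      using eventually_Re_shift_ge[of v]
    proof eventually_elim
      case (elim j)
      show ?case
      proof
        fix s assume s: "s \<in> cball s0 d"
        have "norm ((of_nat j + v) powr (- s)) \<le> exp (pi * \<bar>Im s\<bar>) * (real j / 2) powr (- \<tau>)"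
          using elim d(2) d(3)[OF s] by (intro norm_powr_minus_le) auto
        also have "\<dots> \<le> C * (real j / 2) powr (- \<tau>)"
          unfolding C_def using d(4)[OF s] by (intro mult_right_mono) auto
        finally show "norm ((of_nat j + v) powr (- s)) \<le> C * (real j / 2) powr (- \<tau>)" .
      qed
    qed
  qed (use d in auto)
qed

section \<open>The Hurwitz zeta function\<close>

text \<open>The remainder, with step 1, of the Taylor expansion of \<open>w powr (- u)\<close>.  It has the order
  \<open>w powr (- u - n - 1)\<close>, so summation over \<open>w = j + v\<close> converges in a half plane that grows with
  \<open>n\<close>.\<close>

definition powr_taylor_rem :: "nat \<Rightarrow> complex \<Rightarrow> complex \<Rightarrow> complex" where
  "powr_taylor_rem n u w = (w + 1) powr (- u) -
     (\<Sum>i\<le>n. (- 1) ^ i * pochhammer u i / fact i * w powr (- (u + of_nat i)))"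

lemma norm_powr_taylor_rem_le:
  assumes "Re w \<ge> r" "r \<ge> 1" "0 \<le> \<tau>" "\<tau> \<le> Re u + real n + 1"
  shows "norm (powr_taylor_rem n u w) \<le>
           norm (pochhammer u (Suc n)) * (exp (pi * \<bar>Im u\<bar>) * r powr (- \<tau>)) / fact n"
proof -
  define S where "S = {x. Re x \<ge> r}"
  define f where "f = (\<lambda>i x. (- 1) ^ i * pochhammer u i * x powr (- (u + of_nat i)))"
  have "norm (f 0 (w + 1) - (\<Sum>i\<le>n. f i w * ((w + 1) - w) ^ i / fact i)) \<le>
          (norm (pochhammer u (Suc n)) * (exp (pi * \<bar>Im u\<bar>) * r powr (- \<tau>))) * norm ((w + 1) - w) ^ Suc n / fact n"
  proof (rule complex_Taylor)
    show "convex S" unfolding S_def by (rule convex_halfspace_Re_ge)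
    show "(f i has_field_derivative f (Suc i) x) (at x within S)" if "x \<in> S" for i x
    proof -
      have "x \<notin> \<real>\<^sub>\<le>\<^sub>0" using that assms by (auto simp: S_def complex_nonpos_Reals_iff)
      hence "((\<lambda>x. x powr (- (u + of_nat i))) has_field_derivative
               - (u + of_nat i) * x powr (- (u + of_nat i) - 1)) (at x within S)"
        by (auto intro!: derivative_eq_intros)
      also have "- (u + of_nat i) - 1 = - (u + of_nat (Suc i))" by simp
      finally have "((\<lambda>x. x powr (- (u + of_nat i))) has_field_derivative
               - (u + of_nat i) * x powr (- (u + of_nat (Suc i)))) (at x within S)" .
      from DERIV_cmult[OF this, of "(- 1) ^ i * pochhammer u i"]
      show ?thesis unfolding f_def by (simp add: pochhammer_Suc algebra_simps)
    qed
    show "norm (f (Suc n) x) \<le> norm (pochhammer u (Suc n)) * (exp (pi * \<bar>Im u\<bar>) * r powr (- \<tau>))"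
      if "x \<in> S" for x
    proof -
      have "norm (x powr (- (u + of_nat (Suc n)))) \<le> exp (pi * \<bar>Im (u + of_nat (Suc n))\<bar>) * r powr (- \<tau>)"
        using that assms by (intro norm_powr_minus_le) (auto simp: S_def)
      thus ?thesis unfolding f_def by (simp add: norm_mult norm_power mult_left_mono del: pochhammer_Suc)
    qed
  qed (use assms in \<open>auto simp: S_def\<close>)
  thus ?thesis by (simp add: f_def powr_taylor_rem_def mult_ac)
qed

lemma holomorphic_on_pochhammer:
  "f holomorphic_on A \<Longrightarrow> (\<lambda>s. pochhammer (f s) n :: complex) holomorphic_on A"
  unfolding pochhammer_prod by (intro holomorphic_intros)

lemma powr_taylor_rem_suminf_holomorphic:
  assumes v: "v \<notin> \<int>\<^sub>\<le>\<^sub>0"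
  shows "(\<lambda>s. \<Sum>j. powr_taylor_rem (Suc N) (s - 1) (of_nat j + v)) holomorphic_on {s. Re s > - real N}"
proof (rule holomorphic_on_suminf[OF open_halfspace_Re_gt])
  show "(\<lambda>s. powr_taylor_rem (Suc N) (s - 1) (of_nat j + v)) holomorphic_on {s. Re s > - real N}" for j
    using of_nat_add_nonzero[OF v, of j] of_nat_add_nonzero[OF v, of "Suc j"]
    unfolding powr_taylor_rem_def
    by (intro holomorphic_intros holomorphic_on_pochhammer) (auto simp: add_ac)
  fix s0 assume "s0 \<in> {s. Re s > - real N}"
  then obtain d \<tau> where d: "d > 0" "\<tau> > - real N" "\<And>s. s \<in> cball s0 d \<Longrightarrow> Re s \<ge> \<tau>"
    "\<And>s. s \<in> cball s0 d \<Longrightarrow> \<bar>Im s\<bar> \<le> \<bar>Im s0\<bar> + d"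
    using local_half_plane[of "- real N" s0] by auto
  define \<tau>' where "\<tau>' = \<tau> + real N + 1"
  have "compact ((\<lambda>s. pochhammer (s - 1) (Suc (Suc N))) ` cball s0 d)"
    by (intro compact_continuous_image holomorphic_on_imp_continuous_on holomorphic_on_pochhammer
          holomorphic_intros) auto
  then obtain B where B: "B > 0" "\<And>s. s \<in> cball s0 d \<Longrightarrow> norm (pochhammer (s - 1) (Suc (Suc N))) \<le> B"
    by (auto dest!: compact_imp_bounded simp: bounded_pos)
  define C where "C = B * exp (pi * (\<bar>Im s0\<bar> + d)) / fact (Suc N)"
  show "\<exists>d>0. \<exists>M. summable M \<and> cball s0 d \<subseteq> {s. Re s > - real N} \<and>
          (\<forall>\<^sub>F j in sequentially. \<forall>s\<in>cball s0 d. norm (powr_taylor_rem (Suc N) (s - 1) (of_nat j + v)) \<le> M j)"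
  proof (intro exI conjI)
    show "summable (\<lambda>j. C * (real j / 2) powr (- \<tau>'))"
      by (rule summable_half_powr) (use d in \<open>auto simp: \<tau>'_def\<close>)
    show "cball s0 d \<subseteq> {s. Re s > - real N}" using d by fastforce
    show "\<forall>\<^sub>F j in sequentially. \<forall>s\<in>cball s0 d.
            norm (powr_taylor_rem (Suc N) (s - 1) (of_nat j + v)) \<le> C * (real j / 2) powr (- \<tau>')"
      using eventually_Re_shift_ge[of v]
    proof eventually_elim
      case (elim j)
      show ?case
      proof
        fix s assume s: "s \<in> cball s0 d"
        have "norm (powr_taylor_rem (Suc N) (s - 1) (of_nat j + v)) \<le>
           norm (pochhammer (s - 1) (Suc (Suc N))) * (exp (pi * \<bar>Im (s - 1)\<bar>) * (real j / 2) powr (- \<tau>')) / fact (Suc N)"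
          using elim d(2) d(3)[OF s] by (intro norm_powr_taylor_rem_le) (auto simp: \<tau>'_def)
        also have "\<dots> \<le> B * (exp (pi * (\<bar>Im s0\<bar> + d)) * (real j / 2) powr (- \<tau>')) / fact (Suc N)"
          using d(4)[OF s] B(1) B(2)[OF s]
          by (intro divide_right_mono mult_mono mult_right_mono) auto
        also have "\<dots> = C * (real j / 2) powr (- \<tau>')" by (simp add: C_def)
        finally show "norm (powr_taylor_rem (Suc N) (s - 1) (of_nat j + v)) \<le> C * (real j / 2) powr (- \<tau>')" .
      qed
    qed
  qed (use d in auto)
qed

text \<open>The differences of \<open>(j + v) powr (1 - s)\<close> telescope to \<open>- v powr (1 - s)\<close>.  Expanding each of
  them by Taylor's formula at \<open>j + v\<close> expresses this value by the series at
  \<open>s, s + 1, s + 2, \<dots>\<close> and the sum of the remainders.  The coefficient of the series at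
  \<open>s + k + 1\<close> contains the factor \<open>s + k\<close>; hence the identity is a recurrence for
  \<open>(s - 1) * hurwitz_series v s\<close>, in which the pole has been cleared.\<close>

lemma hurwitz_series_recurrence:
  assumes s: "Re s > 1" and v: "v \<notin> \<int>\<^sub>\<le>\<^sub>0"
  shows "(s - 1) * hurwitz_series v s = v powr (1 - s) +
           (\<Sum>k<N. (- 1) ^ k * (s - 1) * pochhammer s k / fact (k + 2) *
              ((s + of_nat k) * hurwitz_series v (s + of_nat k + 1))) +
           (\<Sum>j. powr_taylor_rem (Suc N) (s - 1) (of_nat j + v))"
proof -
  define a where "a = (\<lambda>i. (- 1) ^ i * pochhammer (s - 1) i / fact i)"
  have lim: "(\<lambda>j. (of_nat j + v) powr (- (s - 1))) \<longlonglongrightarrow> 0"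
  proof (rule Lim_null_comparison)
    show "\<forall>\<^sub>F j in sequentially. norm ((of_nat j + v) powr (- (s - 1))) \<le>
            exp (pi * \<bar>Im (s - 1)\<bar>) * (real j / 2) powr (- Re (s - 1))"
      using eventually_Re_shift_ge[of v]
      by eventually_elim (rule norm_powr_minus_le, use s in auto)
    have "(\<lambda>j. (real j / 2) powr (- Re (s - 1))) \<longlonglongrightarrow> 0"
    proof (rule tendsto_neg_powr)
      show "filterlim (\<lambda>j. real j / 2) at_top sequentially"
        using filterlim_tendsto_pos_mult_at_top[OF tendsto_const _ filterlim_real_sequentially, of "1/2"] by simp
    qed (use s in auto)
    from tendsto_mult_right_zero[OF this]
    show "(\<lambda>j. exp (pi * \<bar>Im (s - 1)\<bar>) * (real j / 2) powr (- Re (s - 1))) \<longlonglongrightarrow> 0" .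
  qed
  have "(\<lambda>j. (of_nat (Suc j) + v) powr (- (s - 1)) - (of_nat j + v) powr (- (s - 1)))
          sums (0 - (of_nat 0 + v) powr (- (s - 1)))"
    by (rule telescope_sums[OF lim])
  hence tel: "(\<lambda>j. (of_nat j + v + 1) powr (- (s - 1)) - (of_nat j + v) powr (- (s - 1)))
          sums (- (v powr (1 - s)))"
    by (simp add: add_ac)
  have main: "(\<lambda>j. \<Sum>i<Suc N. a (Suc i) * (of_nat j + v) powr (- (s + of_nat i)))
          sums (\<Sum>i<Suc N. a (Suc i) * hurwitz_series v (s + of_nat i))"
    using s by (intro sums_sum sums_mult hurwitz_series_sums) auto
  have rem: "(of_nat j + v + 1) powr (- (s - 1)) - (of_nat j + v) powr (- (s - 1)) -
      (\<Sum>i<Suc N. a (Suc i) * (of_nat j + v) powr (- (s + of_nat i))) =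
      powr_taylor_rem (Suc N) (s - 1) (of_nat j + v)" for j
    unfolding powr_taylor_rem_def a_def lessThan_Suc_atMost[symmetric]
    by (subst sum.lessThan_Suc_shift) (simp add: algebra_simps)
  have "(\<lambda>j. powr_taylor_rem (Suc N) (s - 1) (of_nat j + v)) sums
          (- (v powr (1 - s)) - (\<Sum>i<Suc N. a (Suc i) * hurwitz_series v (s + of_nat i)))"
    using sums_diff[OF tel main] unfolding rem .
  hence eq: "(\<Sum>j. powr_taylor_rem (Suc N) (s - 1) (of_nat j + v)) =
          - (v powr (1 - s)) - (\<Sum>i<Suc N. a (Suc i) * hurwitz_series v (s + of_nat i))"
    by (rule sums_unique[symmetric])
  have ak: "a (Suc (Suc k)) * x =
      (- 1) ^ k * (s - 1) * pochhammer s k / fact (k + 2) * ((s + of_nat k) * x)" for k x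
    unfolding a_def pochhammer_rec[of "s - 1" "Suc k"] by (simp add: pochhammer_Suc mult_ac del: fact_Suc)
  have "(\<Sum>i<Suc N. a (Suc i) * hurwitz_series v (s + of_nat i)) =
     - ((s - 1) * hurwitz_series v s) + (\<Sum>k<N. a (Suc (Suc k)) * hurwitz_series v (s + of_nat k + 1))"
    by (subst sum.lessThan_Suc_shift) (simp add: a_def add_ac, metis minus_diff_eq mult_minus_left)
  thus ?thesis unfolding eq ak by (simp add: algebra_simps)
qed

text \<open>The recurrence uses only values to the right of \<open>s\<close>, by at least one unit, and so extends the
  domain by one unit to the left.\<close>

lemma hurwitz_continuation_half_plane:
  assumes v: "v \<notin> \<int>\<^sub>\<le>\<^sub>0"
  shows "\<exists>E. E holomorphic_on {s. Re s > 1 - real N} \<and>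
             (\<forall>s. Re s > 1 \<longrightarrow> E s = (s - 1) * hurwitz_series v s)"
proof (induction N)
  case 0
  show ?case
    by (rule exI[of _ "\<lambda>s. (s - 1) * hurwitz_series v s"])
       (auto intro!: holomorphic_intros hurwitz_series_holomorphic[OF v])
next
  case (Suc N)
  then obtain E where E: "E holomorphic_on {s. Re s > 1 - real N}"
    "\<And>s. Re s > 1 \<Longrightarrow> E s = (s - 1) * hurwitz_series v s" by blast
  define E' where "E' = (\<lambda>s. v powr (1 - s) +
     (\<Sum>k<N. (- 1) ^ k * (s - 1) * pochhammer s k / fact (k + 2) * E (s + of_nat k + 1)) +
     (\<Sum>j. powr_taylor_rem (Suc N) (s - 1) (of_nat j + v)))"
  have v0: "v \<noteq> 0" using v by auto
  have "(\<lambda>s. E (s + of_nat k + 1)) holomorphic_on {s. Re s > - real N}" for k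
    by (rule holomorphic_on_compose_gen[OF _ E(1), unfolded o_def]) (auto intro!: holomorphic_intros)
  hence "E' holomorphic_on {s. Re s > - real N}"
    unfolding E'_def
    by (intro holomorphic_intros holomorphic_on_pochhammer powr_taylor_rem_suminf_holomorphic[OF v])
       (use v0 in auto)
  moreover have "E' s = (s - 1) * hurwitz_series v s" if s: "Re s > 1" for s
    unfolding E'_def hurwitz_series_recurrence[OF s v, of N] using s by (simp add: E(2) add_ac)
  ultimately show ?case by (intro exI[of _ E']) simp
qed

lemma hurwitz_continuation_exists:
  assumes v: "v \<notin> \<int>\<^sub>\<le>\<^sub>0"
  shows "\<exists>f. f holomorphic_on - {1} \<and> (\<forall>s. Re s > 1 \<longrightarrow> f s = hurwitz_series v s)"
proof -
  have "\<forall>N. \<exists>E. E holomorphic_on {s. Re s > 1 - real N} \<and>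
             (\<forall>s. Re s > 1 \<longrightarrow> E s = (s - 1) * hurwitz_series v s)"
    using hurwitz_continuation_half_plane[OF v] by (rule allI)
  from choice[OF this] obtain E where
    E1: "\<And>N. E N holomorphic_on {s. Re s > 1 - real N}" and
    E2: "\<And>N s. Re s > 1 \<Longrightarrow> E N s = (s - 1) * hurwitz_series v s" by blast
  define M where "M = (\<lambda>s. nat \<lceil>\<bar>Re s\<bar>\<rceil> + 2)"
  have M: "Re s > 1 - real (M s)" for s unfolding M_def by linarith
  define F where "F = (\<lambda>s. E (M s) s)"
  have le: "E N s = E N' s" if "Re s > 1 - real N" "N \<le> N'" for s N N'
  proof (rule analytic_continuation_open[of "{s. Re s > 1}" "{s. Re s > 1 - real N}" "E N" "E N'"])
    show "E N' holomorphic_on {s. Re s > 1 - real N}"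
      by (rule holomorphic_on_subset[OF E1[of N']]) (use that in auto)
    have "2 \<in> {s::complex. Re s > 1}" by simp
    thus "{s::complex. Re s > 1} \<noteq> {}" by blast
  qed (use that E1 E2 in \<open>auto simp: open_halfspace_Re_gt intro!: convex_connected convex_halfspace_Re_gt\<close>)
  have eq: "F s = E N s" if "Re s > 1 - real N" for s N
    using le[of "M s" s N] le[of N s "M s"] M[of s] that unfolding F_def by (metis nat_le_linear)
  have "F holomorphic_on (\<Union>N. {s. Re s > 1 - real N})"
  proof (rule holomorphic_on_UN_open)
    fix N
    show "F holomorphic_on {s. Re s > 1 - real N}"
      using E1[of N] by (rule holomorphic_transform) (simp add: eq)
  qed (rule open_halfspace_Re_gt)
  also have "(\<Union>N. {s. Re s > 1 - real N}) = UNIV" using M by auto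
  finally have F: "F holomorphic_on UNIV" .
  show ?thesis
  proof (intro exI[of _ "\<lambda>s. F s / (s - 1)"] conjI allI impI)
    show "(\<lambda>s. F s / (s - 1)) holomorphic_on - {1}"
      by (intro holomorphic_intros holomorphic_on_subset[OF F]) auto
    show "F s / (s - 1) = hurwitz_series v s" if "Re s > 1" for s
      using that by (auto simp: F_def E2)
  qed
qed

lemma hurwitz_zeta_continuation:
  assumes v: "v \<notin> \<int>\<^sub>\<le>\<^sub>0"
  shows hurwitz_zeta_holomorphic: "(\<lambda>s. hurwitz_zeta s v) holomorphic_on - {1}"
    and hurwitz_zeta_eq_series: "Re s > 1 \<Longrightarrow> hurwitz_zeta s v = lerch_series 1 s v"
proof -
  let ?P = "\<lambda>f. f holomorphic_on - {1} \<and> (\<forall>t. Re t > 1 \<longrightarrow> f t = lerch_series 1 t v)"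
  have "\<exists>f. ?P f" using hurwitz_continuation_exists[OF v] by (simp add: lerch_series_altdef)
  hence "?P (SOME f. ?P f)" by (rule someI_ex)
  hence "?P (\<lambda>s. hurwitz_zeta s v)" unfolding hurwitz_zeta_def .
  thus "(\<lambda>s. hurwitz_zeta s v) holomorphic_on - {1}"
    "Re s > 1 \<Longrightarrow> hurwitz_zeta s v = lerch_series 1 s v" by blast+
qed

section \<open>The values of the Hurwitz-Lerch zeta function\<close>

lemma lerch_phi_sums_disc:
  assumes "v \<notin> \<int>\<^sub>\<le>\<^sub>0" "norm z < 1"
  shows "(\<lambda>j. z ^ j * (of_nat j + v) powr (- s)) sums lerch_phi z s v"
  using lerch_extension_sums[OF assms(1), of z s] assms(2)
  by (simp add: lerch_phi_def lerch_series_altdef sums_iff)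

lemma lerch_phi_sums_closed_disc:
  assumes "Re s > 1" "norm z \<le> 1"
  shows "(\<lambda>j. z ^ j * (of_nat j + v) powr (- s)) sums lerch_phi z s v"
  using summable_norm_cancel[OF summable_norm_lerch[OF assms]] assms
  by (auto simp: lerch_phi_def lerch_series_altdef sums_iff)

lemma lerch_phi_one: "v \<notin> \<int>\<^sub>\<le>\<^sub>0 \<Longrightarrow> lerch_phi 1 s v = hurwitz_zeta s v"
  by (simp add: lerch_phi_def hurwitz_zeta_eq_series)

text \<open>For \<open>Re s > 1\<close> the series converges uniformly on the closed unit disc, hence is continuous there.
  So at a point \<open>z \<noteq> 1\<close> of the unit circle both sides are the radial limit of the same
  function.\<close>

lemma lerch_series_eq_extension_circle:
  assumes v: "v \<notin> \<int>\<^sub>\<le>\<^sub>0" and s: "Re s > 1" and z: "norm z = 1" "z \<in> lerch_slit_plane"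
  shows "lerch_series z s v = lerch_extension v z s"
proof -
  define Z where "Z = (\<lambda>n. z * of_real (1 - inverse (real (Suc n))))"
  have small: "norm (Z n) < 1" for n
  proof -
    have "inverse (real (Suc n)) \<le> 1" by (simp add: field_simps)
    hence "norm (Z n) = 1 - inverse (real (Suc n))"
      unfolding Z_def norm_mult norm_of_real using z by simp
    thus ?thesis by simp
  qed
  have "(\<lambda>n. 1 - inverse (real (Suc n))) \<longlonglongrightarrow> 1 - 0"
    by (intro tendsto_diff tendsto_const LIMSEQ_inverse_real_of_nat)
  hence "(\<lambda>n. z * of_real (1 - inverse (real (Suc n)))) \<longlonglongrightarrow> z * of_real (1 - 0)"
    by (intro tendsto_mult tendsto_of_real tendsto_const)
  hence Z: "Z \<longlonglongrightarrow> z" by (simp add: Z_def)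
  have "uniform_limit (cball 0 1) (\<lambda>n z. \<Sum>j<n. z ^ j * (of_nat j + v) powr (- s))
          (\<lambda>z. \<Sum>j. z ^ j * (of_nat j + v) powr (- s)) sequentially"
    by (rule Weierstrass_m_test[OF _ summable_norm_lerch[OF s, of 1 v]])
       (auto simp: norm_mult norm_power intro!: mult_left_le_one_le power_le_one)
  hence "continuous_on (cball 0 1) (\<lambda>z. \<Sum>j. z ^ j * (of_nat j + v) powr (- s))"
    by (rule uniform_limit_theorem[rotated]) (auto intro!: always_eventually continuous_intros)
  hence "continuous_on (cball 0 1) (\<lambda>z. lerch_series z s v)"
    by (simp add: lerch_series_altdef)
  hence lim1: "(\<lambda>n. lerch_series (Z n) s v) \<longlonglongrightarrow> lerch_series z s v"
    by (rule continuous_on_tendsto_compose[OF _ Z])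
       (use z small in \<open>auto intro!: always_eventually less_imp_le\<close>)
  have "isCont (\<lambda>z. lerch_extension v z s) z"
    using holomorphic_on_imp_continuous_on[OF lerch_extension_holomorphic_z[OF v]] z
    by (simp add: continuous_on_eq_continuous_at open_lerch_slit_plane)
  hence "(\<lambda>n. lerch_extension v (Z n) s) \<longlonglongrightarrow> lerch_extension v z s"
    using Z by (rule isCont_tendsto_compose)
  moreover have "lerch_extension v (Z n) s = lerch_series (Z n) s v" for n
    using lerch_extension_sums[OF v, of "Z n" s] small[of n] by (simp add: sums_iff lerch_series_altdef)
  ultimately show ?thesis using lim1 LIMSEQ_unique by auto
qed

text \<open>So on the slit plane the series and the continuation in the definition of \<open>lerch_phi\<close> are
  pieces of one function, and regularity in \<open>z\<close> and \<open>s\<close> comes from the joint continuation.\<close>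

lemma lerch_phi_slit_plane:
  assumes v: "v \<notin> \<int>\<^sub>\<le>\<^sub>0" and z: "z \<in> lerch_slit_plane"
  shows "lerch_phi z s v = lerch_extension v z s"
proof -
  have "lerch_series z s v = lerch_extension v z s" if "norm z < 1"
    using lerch_extension_sums[OF v, of z s] that by (simp add: sums_iff lerch_series_altdef)
  moreover have "z \<noteq> 1" using z by (auto simp: lerch_slit_plane_iff)
  ultimately show ?thesis
    using lerch_series_eq_extension_circle[OF v _ _ z] lerch_continuation_eq[OF v z]
    by (auto simp: lerch_phi_def)
qed

lemma lerch_phi_holomorphic_z:
  assumes "v \<notin> \<int>\<^sub>\<le>\<^sub>0"
  shows "(\<lambda>z. lerch_phi z s v) holomorphic_on lerch_slit_plane"
  using lerch_extension_holomorphic_z[OF assms] by (rule holomorphic_transform) (simp add: lerch_phi_slit_plane assms)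

lemma unit_circle_slit_plane: "norm z = 1 \<Longrightarrow> z \<noteq> 1 \<Longrightarrow> z \<in> lerch_slit_plane"
  using complex_Re_le_cmod[of z] cmod_eq_Re[of z] by (fastforce simp: lerch_slit_plane_iff complex_eq_iff)

text \<open>On the unit circle the point \<open>z = 1\<close>, where the value is the Hurwitz zeta function, needs no
  distinction from the others, once the pole \<open>s = 1\<close> is removed.\<close>

lemma lerch_phi_holomorphic_s:
  assumes v: "v \<notin> \<int>\<^sub>\<le>\<^sub>0" and z: "norm z = 1"
  shows "(\<lambda>s. lerch_phi z s v) holomorphic_on - {1}"
proof (cases "z = 1")
  case True
  thus ?thesis using hurwitz_zeta_holomorphic[OF v] by (simp add: lerch_phi_one[OF v])
next
  case False
  hence z': "z \<in> lerch_slit_plane" by (rule unit_circle_slit_plane[OF z])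
  show ?thesis
    using holomorphic_on_subset[OF lerch_extension_holomorphic_s[OF v z'], of "- {1}"]
    by (simp add: lerch_phi_slit_plane[OF v z'])
qed

lemma powr_times_pos_real_left:
  assumes "r > 0"
  shows "(of_real r * w) powr a = of_real r powr a * (w powr a :: complex)"
proof (cases "w = 0")
  case False
  with assms show ?thesis
    by (simp add: powr_def Ln_times_of_real exp_add[symmetric] ring_distribs Ln_of_real)
qed auto

section \<open>Trisection of the Hurwitz-Lerch zeta function\<close>

text \<open>Orthogonality of the cube roots of unity: \<open>1 + \<zeta> ^ (j + 1) + \<zeta> ^ (2 * (j + 1))\<close> is 3 if
  \<open>j\<close> is congruent to 2 modulo 3 and vanishes otherwise.\<close>

lemma trisection_sums:
  fixes \<zeta> :: complex
  assumes \<zeta>: "1 + \<zeta> + \<zeta>\<^sup>2 = 0"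
    and A: "(\<lambda>j. y ^ j * c j) sums A" and B: "(\<lambda>j. (\<zeta> * y) ^ j * c j) sums B"
    and C: "(\<lambda>j. (\<zeta>\<^sup>2 * y) ^ j * c j) sums C"
  shows "(\<lambda>l. 3 * y\<^sup>2 * ((y ^ 3) ^ l * c (3 * l + 2))) sums (A + \<zeta> * B + \<zeta>\<^sup>2 * C)"
proof -
  have \<zeta>3: "\<zeta> ^ 3 = 1" using \<zeta> by algebra
  define b where "b = (\<lambda>j. (1 + \<zeta> ^ Suc j + (\<zeta> ^ Suc j)\<^sup>2) * (y ^ j * c j))"
  have "(\<lambda>j. y ^ j * c j + \<zeta> * ((\<zeta> * y) ^ j * c j) + \<zeta>\<^sup>2 * ((\<zeta>\<^sup>2 * y) ^ j * c j)) sums (A + \<zeta> * B + \<zeta>\<^sup>2 * C)"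
    by (intro sums_add sums_mult A B C)
  also have "(\<lambda>j. y ^ j * c j + \<zeta> * ((\<zeta> * y) ^ j * c j) + \<zeta>\<^sup>2 * ((\<zeta>\<^sup>2 * y) ^ j * c j)) = b"
    by (auto simp: b_def power_mult_distrib algebra_simps power2_eq_square)
  finally have "b sums (A + \<zeta> * B + \<zeta>\<^sup>2 * C)" .
  moreover have "b j = 0" if "j \<notin> range (\<lambda>l. 3 * l + 2)" for j
  proof -
    have "j mod 3 \<noteq> 2"
    proof
      assume "j mod 3 = 2"
      hence "j = 3 * (j div 3) + 2" by presburger
      thus False using that by blast
    qed
    hence "Suc j mod 3 = 1 \<or> Suc j mod 3 = 2" by presburger
    moreover have "\<zeta> ^ Suc j = \<zeta> ^ (Suc j mod 3)"
    proof -
      have "\<zeta> ^ (3 * (Suc j div 3) + Suc j mod 3) = \<zeta> ^ (Suc j mod 3)"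
        by (simp only: power_add power_mult \<zeta>3) simp
      thus ?thesis by simp
    qed
    ultimately have "\<zeta> ^ Suc j = \<zeta> \<or> \<zeta> ^ Suc j = \<zeta>\<^sup>2" by auto
    hence "1 + \<zeta> ^ Suc j + (\<zeta> ^ Suc j)\<^sup>2 = 0"
    proof
      assume e: "\<zeta> ^ Suc j = \<zeta>"
      show ?thesis unfolding e by (rule \<zeta>)
    next
      assume e: "\<zeta> ^ Suc j = \<zeta>\<^sup>2"
      show ?thesis unfolding e using \<zeta> by algebra
    qed
    thus ?thesis by (simp only: b_def) simp
  qed
  ultimately have "(\<lambda>l. b (3 * l + 2)) sums (A + \<zeta> * B + \<zeta>\<^sup>2 * C)"
    by (subst sums_mono_reindex) (auto simp: strict_mono_def)
  also have "(\<lambda>l. b (3 * l + 2)) = (\<lambda>l. 3 * y\<^sup>2 * ((y ^ 3) ^ l * c (3 * l + 2)))"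
  proof
    fix l
    have "\<zeta> ^ Suc (3 * l + 2) = 1"
    proof -
      have "Suc (3 * l + 2) = 3 * Suc l" by simp
      thus ?thesis by (simp only: power_mult \<zeta>3) simp
    qed
    hence "b (3 * l + 2) = 3 * (y ^ (3 * l + 2) * c (3 * l + 2))" by (simp only: b_def) simp
    also have "y ^ (3 * l + 2) = y\<^sup>2 * (y ^ 3) ^ l" by (simp add: power_add power_mult[symmetric] mult.commute power2_eq_square)
    finally show "b (3 * l + 2) = 3 * y\<^sup>2 * ((y ^ 3) ^ l * c (3 * l + 2))" by (simp add: mult_ac)
  qed
  finally show ?thesis .
qed

text \<open>The surviving terms have \<open>j + v = 3 * (l + (v + 2) / 3)\<close>; the factor 3 is a positive real and
  splits off from the principal power.\<close>

lemma lerch_trisection_of_sums: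
  fixes \<zeta> :: complex
  assumes \<zeta>: "1 + \<zeta> + \<zeta>\<^sup>2 = 0"
    and "(\<lambda>j. y ^ j * (of_nat j + v) powr (- s)) sums A"
    and "(\<lambda>j. (\<zeta> * y) ^ j * (of_nat j + v) powr (- s)) sums B"
    and "(\<lambda>j. (\<zeta>\<^sup>2 * y) ^ j * (of_nat j + v) powr (- s)) sums C"
    and D: "(\<lambda>j. (y ^ 3) ^ j * (of_nat j + (v + 2) / 3) powr (- s)) sums D"
  shows "A + \<zeta> * B + \<zeta>\<^sup>2 * C = 3 powr (1 - s) * y\<^sup>2 * D"
proof -
  have pw: "(of_nat (3 * l + 2) + v) powr (- s) = 3 powr (- s) * (of_nat l + (v + 2) / 3) powr (- s)" for l
  proof -
    have "(of_nat (3 * l + 2) + v) powr (- s) = (of_real 3 * (of_nat l + (v + 2) / 3)) powr (- s)"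
      by (rule arg_cong[where f = "\<lambda>x. x powr (- s)"]) (simp add: field_simps)
    also have "(of_real 3 * (of_nat l + (v + 2) / 3)) powr (- s) =
        of_real 3 powr (- s) * (of_nat l + (v + 2) / 3) powr (- s)"
      by (rule powr_times_pos_real_left) simp
    finally show ?thesis by simp
  qed
  have eq: "3 * y\<^sup>2 * ((y ^ 3) ^ l * (of_nat (3 * l + 2) + v) powr (- s)) =
          3 powr (1 - s) * y\<^sup>2 * ((y ^ 3) ^ l * (of_nat l + (v + 2) / 3) powr (- s))" for l
    unfolding pw by (simp add: powr_diff powr_minus field_simps)
  have "(\<lambda>l. 3 powr (1 - s) * y\<^sup>2 * ((y ^ 3) ^ l * (of_nat l + (v + 2) / 3) powr (- s)))
          sums (A + \<zeta> * B + \<zeta>\<^sup>2 * C)"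
    using trisection_sums[OF assms(1-4)] unfolding eq .
  thus ?thesis using sums_mult[OF D, of "3 powr (1 - s) * y\<^sup>2"] by (rule sums_unique2)
qed

text \<open>If \<open>y ^ 3\<close> is a real \<open>x \<ge> 1\<close>, then one of the three rotations of \<open>y\<close> is the real cube root
  of \<open>x\<close>, which lies on the cut.\<close>

lemma cube_in_slit_plane:
  fixes \<zeta> :: complex
  assumes \<zeta>: "1 + \<zeta> + \<zeta>\<^sup>2 = 0"
    and y: "y \<in> lerch_slit_plane" "\<zeta> * y \<in> lerch_slit_plane" "\<zeta>\<^sup>2 * y \<in> lerch_slit_plane"
  shows "y ^ 3 \<in> lerch_slit_plane"
proof (rule ccontr)
  assume "y ^ 3 \<notin> lerch_slit_plane"
  then obtain x where x: "x \<ge> 1" "y ^ 3 = of_real x" by (auto simp: lerch_slit_plane_def)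
  define c where "c = root 3 x"
  have c: "c \<ge> 1" "c ^ 3 = x" using x by (auto simp: c_def)
  have "y ^ 3 = of_real c ^ 3" using x c by (simp flip: of_real_power)
  hence "(y - of_real c) * (\<zeta> * y - of_real c) * (\<zeta>\<^sup>2 * y - of_real c) = 0"
    using \<zeta> by algebra
  hence "of_real c \<in> lerch_slit_plane" using y by auto
  thus False using c by (simp add: lerch_slit_plane_iff)
qed

lemma third_notin_nonpos_Ints:
  fixes v :: complex
  assumes "v \<notin> \<int>\<^sub>\<le>\<^sub>0"
  shows "(v + 2) / 3 \<notin> \<int>\<^sub>\<le>\<^sub>0"
proof
  assume "(v + 2) / 3 \<in> \<int>\<^sub>\<le>\<^sub>0"
  then obtain i :: int where "(v + 2) / 3 = of_int i" "i \<le> 0" by (elim nonpos_Ints_cases)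
  hence "v = of_int (3 * i - 2)" "3 * i - 2 \<le> 0" by (auto simp: field_simps)
  thus False using assms nonpos_Ints_of_int by blast
qed

lemma norm_primitive_cube_root:
  fixes \<zeta> :: complex
  assumes "1 + \<zeta> + \<zeta>\<^sup>2 = 0"
  shows "norm \<zeta> = 1"
proof -
  have "\<zeta> ^ 3 = 1" using assms by algebra
  hence "norm \<zeta> ^ 3 = 1" by (metis norm_one norm_power)
  thus ?thesis using power_eq_imp_eq_base[of "norm \<zeta>" 3 1] by simp
qed

text \<open>Continuation in \<open>z\<close> from the unit disc: the plane without the three rays on which one of the
  arguments meets the cut is star-shaped about 0.\<close>

lemma lerch_trisection_slit_plane:
  fixes \<zeta> :: complex
  assumes \<zeta>: "1 + \<zeta> + \<zeta>\<^sup>2 = 0" and v: "v \<notin> \<int>\<^sub>\<le>\<^sub>0"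
    and y: "y \<in> lerch_slit_plane" "\<zeta> * y \<in> lerch_slit_plane" "\<zeta>\<^sup>2 * y \<in> lerch_slit_plane"
  shows "lerch_phi y s v + \<zeta> * lerch_phi (\<zeta> * y) s v + \<zeta>\<^sup>2 * lerch_phi (\<zeta>\<^sup>2 * y) s v =
           3 powr (1 - s) * y\<^sup>2 * lerch_phi (y ^ 3) s ((v + 2) / 3)"
proof -
  have n\<zeta>: "norm \<zeta> = 1" by (rule norm_primitive_cube_root[OF \<zeta>])
  define X where "X = {y. y \<in> lerch_slit_plane \<and> \<zeta> * y \<in> lerch_slit_plane \<and> \<zeta>\<^sup>2 * y \<in> lerch_slit_plane}"
  have ball: "ball 0 1 \<subseteq> X"
    using unit_ball_subset_lerch_slit_plane n\<zeta> by (auto simp: X_def norm_mult norm_power subset_iff)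
  have "X = lerch_slit_plane \<inter> (\<lambda>y. \<zeta> * y) -` lerch_slit_plane \<inter> (\<lambda>y. \<zeta>\<^sup>2 * y) -` lerch_slit_plane"
    by (auto simp: X_def)
  hence openX: "open X"
    by (auto intro!: open_Int open_vimage open_lerch_slit_plane continuous_intros)
  have "starlike X"
    unfolding starlike_def
  proof (intro bexI[of _ 0] ballI subsetI)
    fix x w assume x: "x \<in> X" and "w \<in> closed_segment 0 x"
    then obtain u where u: "0 \<le> u" "u \<le> 1" "w = x * of_real u"
      by (auto simp: in_segment scaleR_conv_of_real mult.commute)
    show "w \<in> X"
      using x lerch_slit_plane_scale[OF _ u(1,2)] unfolding X_def u(3) by (simp add: mult.assoc[symmetric])
  qed (use ball in auto)
  hence connX: "connected X" by (rule starlike_imp_connected)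
  show ?thesis
  proof (rule analytic_continuation_open[OF open_ball openX, of 0 1
      "\<lambda>y. lerch_phi y s v + \<zeta> * lerch_phi (\<zeta> * y) s v + \<zeta>\<^sup>2 * lerch_phi (\<zeta>\<^sup>2 * y) s v"
      "\<lambda>y. 3 powr (1 - s) * y\<^sup>2 * lerch_phi (y ^ 3) s ((v + 2) / 3)"])
    show "connected X" by (rule connX)
    show "(\<lambda>y. lerch_phi y s v + \<zeta> * lerch_phi (\<zeta> * y) s v + \<zeta>\<^sup>2 * lerch_phi (\<zeta>\<^sup>2 * y) s v) holomorphic_on X"
      by (intro holomorphic_intros
            holomorphic_on_compose_gen[OF _ lerch_phi_holomorphic_z[OF v], unfolded o_def])
         (auto simp: X_def)
    show "(\<lambda>y. 3 powr (1 - s) * y\<^sup>2 * lerch_phi (y ^ 3) s ((v + 2) / 3)) holomorphic_on X"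
      by (intro holomorphic_intros
            holomorphic_on_compose_gen[OF _ lerch_phi_holomorphic_z[OF third_notin_nonpos_Ints[OF v]], unfolded o_def])
         (auto simp: X_def intro: cube_in_slit_plane[OF \<zeta>])
    fix y :: complex assume "y \<in> ball 0 1"
    thus "lerch_phi y s v + \<zeta> * lerch_phi (\<zeta> * y) s v + \<zeta>\<^sup>2 * lerch_phi (\<zeta>\<^sup>2 * y) s v =
           3 powr (1 - s) * y\<^sup>2 * lerch_phi (y ^ 3) s ((v + 2) / 3)"
      using n\<zeta> by (intro lerch_trisection_of_sums[OF \<zeta>, where v = v] lerch_phi_sums_disc v third_notin_nonpos_Ints)
        (auto simp: norm_mult norm_power power_less_one_iff)
  qed (use ball y in \<open>auto simp: X_def\<close>)
qed

text \<open>Continuation in \<open>s\<close> from \<open>Re s > 1\<close>, where all four series converge on the unit circle.  This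
  covers the case where one of the arguments is 1, in which continuation in \<open>z\<close> is impossible.\<close>

lemma lerch_trisection_circle:
  fixes \<zeta> :: complex
  assumes \<zeta>: "1 + \<zeta> + \<zeta>\<^sup>2 = 0" and v: "v \<notin> \<int>\<^sub>\<le>\<^sub>0" and y: "norm y = 1" and s: "s \<noteq> 1"
  shows "lerch_phi y s v + \<zeta> * lerch_phi (\<zeta> * y) s v + \<zeta>\<^sup>2 * lerch_phi (\<zeta>\<^sup>2 * y) s v =
           3 powr (1 - s) * y\<^sup>2 * lerch_phi (y ^ 3) s ((v + 2) / 3)"
proof -
  have n\<zeta>: "norm \<zeta> = 1" by (rule norm_primitive_cube_root[OF \<zeta>])
  show ?thesis
  proof (rule analytic_continuation_open[of "{s. Re s > 1}" "- {1}"
      "\<lambda>s. lerch_phi y s v + \<zeta> * lerch_phi (\<zeta> * y) s v + \<zeta>\<^sup>2 * lerch_phi (\<zeta>\<^sup>2 * y) s v"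
      "\<lambda>s. 3 powr (1 - s) * y\<^sup>2 * lerch_phi (y ^ 3) s ((v + 2) / 3)"])
    show "open {s. Re s > 1}" by (rule open_halfspace_Re_gt)
    have "2 \<in> {s::complex. Re s > 1}" by simp
    thus "{s::complex. Re s > 1} \<noteq> {}" by blast
    show "connected (- {1 :: complex})"
      by (rule connected_punctured_universe) simp
    show "(\<lambda>s. lerch_phi y s v + \<zeta> * lerch_phi (\<zeta> * y) s v + \<zeta>\<^sup>2 * lerch_phi (\<zeta>\<^sup>2 * y) s v) holomorphic_on - {1}"
      using y n\<zeta> by (intro holomorphic_intros lerch_phi_holomorphic_s v) (auto simp: norm_mult norm_power)
    show "(\<lambda>s. 3 powr (1 - s) * y\<^sup>2 * lerch_phi (y ^ 3) s ((v + 2) / 3)) holomorphic_on - {1}"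
      using y by (intro holomorphic_intros lerch_phi_holomorphic_s third_notin_nonpos_Ints v) (auto simp: norm_power)
    fix s :: complex assume "s \<in> {s. Re s > 1}"
    thus "lerch_phi y s v + \<zeta> * lerch_phi (\<zeta> * y) s v + \<zeta>\<^sup>2 * lerch_phi (\<zeta>\<^sup>2 * y) s v =
           3 powr (1 - s) * y\<^sup>2 * lerch_phi (y ^ 3) s ((v + 2) / 3)"
      using y n\<zeta> by (intro lerch_trisection_of_sums[OF \<zeta>, where v = v] lerch_phi_sums_closed_disc)
        (auto simp: norm_mult norm_power)
  qed (use s in auto)
qed

text \<open>If one of the three arguments is 1, then \<open>y\<close> is itself a cube root of unity and lies on the unit
  circle.  The first part is what allows the identity to be iterated along \<open>y, y ^ 3, y ^ 9, \<dots>\<close>\<close>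

lemma lerch_trisection:
  fixes \<zeta> :: complex
  assumes \<zeta>: "1 + \<zeta> + \<zeta>\<^sup>2 = 0"
    and y: "lerch_phi_defined y s v" "lerch_phi_defined (\<zeta> * y) s v" "lerch_phi_defined (\<zeta>\<^sup>2 * y) s v"
  shows "lerch_phi_defined (y ^ 3) s ((v + 2) / 3)"
    and "lerch_phi y s v + \<zeta> * lerch_phi (\<zeta> * y) s v + \<zeta>\<^sup>2 * lerch_phi (\<zeta>\<^sup>2 * y) s v =
           3 powr (1 - s) * y\<^sup>2 * lerch_phi (y ^ 3) s ((v + 2) / 3)"
proof -
  have v: "v \<notin> \<int>\<^sub>\<le>\<^sub>0" using y by (simp add: lerch_phi_defined_def)
  have "lerch_phi_defined (y ^ 3) s ((v + 2) / 3) \<and>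
    lerch_phi y s v + \<zeta> * lerch_phi (\<zeta> * y) s v + \<zeta>\<^sup>2 * lerch_phi (\<zeta>\<^sup>2 * y) s v =
           3 powr (1 - s) * y\<^sup>2 * lerch_phi (y ^ 3) s ((v + 2) / 3)"
  proof (cases "y \<in> lerch_slit_plane \<and> \<zeta> * y \<in> lerch_slit_plane \<and> \<zeta>\<^sup>2 * y \<in> lerch_slit_plane")
    case True
    thus ?thesis
      using lerch_trisection_slit_plane[OF \<zeta> v] cube_in_slit_plane[OF \<zeta>] third_notin_nonpos_Ints[OF v]
      by (auto simp: lerch_phi_defined_def)
  next
    case False
    hence "s \<noteq> 1" and or: "y = 1 \<or> \<zeta> * y = 1 \<or> \<zeta>\<^sup>2 * y = 1"
      using y by (auto simp: lerch_phi_defined_def)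
    have "\<zeta> ^ 3 = 1" using \<zeta> by algebra
    hence y3: "y ^ 3 = 1" using or by algebra
    hence "norm y ^ 3 = 1" by (metis norm_one norm_power)
    hence "norm y = 1" using power_eq_imp_eq_base[of "norm y" 3 1] by simp
    thus ?thesis
      using lerch_trisection_circle[OF \<zeta> v _ \<open>s \<noteq> 1\<close>] \<open>s \<noteq> 1\<close> third_notin_nonpos_Ints[OF v] y3
      by (auto simp: lerch_phi_defined_def)
  qed
  thus "lerch_phi_defined (y ^ 3) s ((v + 2) / 3)"
    and "lerch_phi y s v + \<zeta> * lerch_phi (\<zeta> * y) s v + \<zeta>\<^sup>2 * lerch_phi (\<zeta>\<^sup>2 * y) s v =
           3 powr (1 - s) * y\<^sup>2 * lerch_phi (y ^ 3) s ((v + 2) / 3)" by blast+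
qed

section \<open>The finite sum\<close>

lemma cube_root_minus_one:
  defines "\<omega> \<equiv> (-1 :: complex) powr (1/3)"
  shows "\<omega>\<^sup>2 - \<omega> + 1 = 0" and "(-1) powr (2/3) = \<omega>\<^sup>2"
proof -
  have "\<omega> = cis (pi / 3)" by (simp add: \<omega>_def powr_def cis_conv_exp mult_ac)
  hence re: "Re \<omega> = 1 / 2" and im: "Im \<omega> = sqrt 3 / 2" by (simp_all add: cos_60 sin_60)
  show "\<omega>\<^sup>2 - \<omega> + 1 = 0"
    by (simp add: complex_eq_iff power2_eq_square re im)
  have "\<omega>\<^sup>2 = (-1) powr (1/3 + 1/3)" unfolding \<omega>_def power2_eq_square powr_add ..
  thus "(-1) powr (2/3) = \<omega>\<^sup>2" by simp
qed

theorem theorem4p149: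
  fixes n :: nat and k m a :: complex
  assumes "n \<ge> 1"
    and "a \<noteq> 0 \<or> Re k > 0"
    and "\<And>p. p \<in> {1..n} \<Longrightarrow>
           lerch_phi_defined ((-1) powr (1/3) * exp (\<i> * 3^p * m)) (-k) (1 - \<i> * a / 3^p)"
    and "\<And>p. p \<in> {1..n} \<Longrightarrow>
           lerch_phi_defined (- ((-1) powr (2/3)) * exp (\<i> * 3^p * m)) (-k) (1 - \<i> * a / 3^p)"
    and "lerch_phi_defined (- exp (3 * \<i> * m)) (-k) (1 - \<i> * a / 3)"
    and "lerch_phi_defined (- exp (\<i> * 3^(1+n) * m)) (-k) (1 - \<i> * a / 3^(1+n))"
  shows "(\<Sum>p=1..n. 3^p *
            (a powr k + (-1) powr (1/3) * (\<i> * 3^p) powr k * exp (\<i> * 3^p * m) *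
               (lerch_phi ((-1) powr (1/3) * exp (\<i> * 3^p * m)) (-k) (1 - \<i> * a / 3^p)
                - (-1) powr (1/3) *
                  lerch_phi (- ((-1) powr (2/3)) * exp (\<i> * 3^p * m)) (-k) (1 - \<i> * a / 3^p))))
         = 3/2 * ((-1 + 3^n) * a powr k
              + 2 * (3 * \<i>) powr k * exp (3 * \<i> * m) *
                  lerch_phi (- exp (3 * \<i> * m)) (-k) (1 - \<i> * a / 3)
              - 2 * 3^n * (\<i> * 3^(1+n)) powr k * exp (\<i> * 3^(1+n) * m) *
                  lerch_phi (- exp (\<i> * 3^(1+n) * m)) (-k) (1 - \<i> * a / 3^(1+n)))"
proof -
  define \<omega> where "\<omega> = (-1 :: complex) powr (1/3)"
  have \<omega>: "\<omega>\<^sup>2 - \<omega> + 1 = 0" and \<omega>2: "(-1) powr (2/3) = \<omega>\<^sup>2"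
    using cube_root_minus_one by (simp_all add: \<omega>_def)
  \<comment> \<open>In these terms \<open>\<omega> * x p\<close> and \<open>- \<omega>\<^sup>2 * x p\<close> are the rotations of \<open>- x p\<close> by \<open>\<zeta>\<^sup>2\<close> and \<open>\<zeta>\<close>.\<close>
  define \<zeta> where "\<zeta> = \<omega>\<^sup>2"
  have \<zeta>: "1 + \<zeta> + \<zeta>\<^sup>2 = 0" and \<zeta>2: "\<zeta>\<^sup>2 = - \<omega>" unfolding \<zeta>_def using \<omega> by algebra+
  define x where "x = (\<lambda>p::nat. exp (\<i> * 3 ^ p * m))"
  define w where "w = (\<lambda>p::nat. 1 - \<i> * a / 3 ^ p)"
  define K where "K = (\<lambda>p::nat. (\<i> * 3 ^ p) powr k)"
  define T where "T = (\<lambda>p. 3 ^ p * (a powr k + \<omega> * K p * x p *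
      (lerch_phi (\<omega> * x p) (-k) (w p) - \<omega> * lerch_phi (- (\<omega>\<^sup>2) * x p) (-k) (w p))))"
  define S where "S = (\<lambda>p. 3 ^ p * K p * x p * lerch_phi (- x p) (-k) (w p))"
  have x_Suc: "x (Suc p) = x p ^ 3" for p
    by (simp add: x_def exp_of_nat_mult[symmetric] mult_ac)
  have w_Suc: "w (Suc p) = (w p + 2) / 3" for p by (simp add: w_def field_simps)
  have K_Suc: "K (Suc p) = 3 powr k * K p" for p
    using powr_times_pos_real_left[of 3 "\<i> * 3 ^ p" k] by (simp add: K_def mult_ac)
  have step: "lerch_phi_defined (- x (Suc p)) (-k) (w (Suc p)) \<and>
      T p = 3 ^ p * a powr k + S p - S (Suc p)"
    if p: "p \<in> {1..n}" and d: "lerch_phi_defined (- x p) (-k) (w p)" for p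
  proof -
    have e: "\<zeta> * - x p = - (\<omega>\<^sup>2) * x p" "\<zeta>\<^sup>2 * - x p = \<omega> * x p"
      unfolding \<zeta>2 by (simp_all add: \<zeta>_def)
    have d': "lerch_phi_defined (\<zeta> * - x p) (-k) (w p)" "lerch_phi_defined (\<zeta>\<^sup>2 * - x p) (-k) (w p)"
      unfolding e using assms(3,4)[OF p] by (simp_all add: x_def w_def \<omega>_def[symmetric] \<omega>2)
    have "lerch_phi (- x p) (-k) (w p) + \<omega>\<^sup>2 * lerch_phi (- (\<omega>\<^sup>2) * x p) (-k) (w p)
        - \<omega> * lerch_phi (\<omega> * x p) (-k) (w p) =
        3 * 3 powr k * (x p)\<^sup>2 * lerch_phi (- x (Suc p)) (-k) (w (Suc p))"
      using lerch_trisection(2)[OF \<zeta> d d'] unfolding e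
      by (simp add: \<zeta>2 x_Suc w_Suc powr_add) (simp add: \<zeta>_def)
    hence eq: "\<omega> * (lerch_phi (\<omega> * x p) (-k) (w p) - \<omega> * lerch_phi (- (\<omega>\<^sup>2) * x p) (-k) (w p)) =
        lerch_phi (- x p) (-k) (w p) -
        3 * 3 powr k * (x p)\<^sup>2 * lerch_phi (- x (Suc p)) (-k) (w (Suc p))"
      by (simp add: algebra_simps power2_eq_square)
    have "T p = 3 ^ p * (a powr k + K p * x p * (\<omega> * (lerch_phi (\<omega> * x p) (-k) (w p) -
        \<omega> * lerch_phi (- (\<omega>\<^sup>2) * x p) (-k) (w p))))"
      unfolding T_def by (simp only: mult_ac)
    hence "T p = 3 ^ p * (a powr k + K p * x p * (lerch_phi (- x p) (-k) (w p) -
        3 * 3 powr k * (x p)\<^sup>2 * lerch_phi (- x (Suc p)) (-k) (w (Suc p))))"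
      unfolding eq .
    hence "T p = 3 ^ p * a powr k + S p - S (Suc p)"
      unfolding S_def K_Suc by (subst x_Suc) (simp add: algebra_simps power2_eq_square power3_eq_cube)
    thus ?thesis using lerch_trisection(1)[OF \<zeta> d d'] by (simp add: x_Suc w_Suc)
  qed
  \<comment> \<open>Between the first and the last of the points \<open>- x p\<close>, each inherits admissibility
      from its predecessor.\<close>
  have defd: "lerch_phi_defined (- x (Suc p)) (-k) (w (Suc p))" if "p \<le> n" for p
    using that
  proof (induction p)
    case 0
    thus ?case using assms(5) by (simp add: x_def w_def mult_ac)
  next
    case (Suc p)
    thus ?case using step[of "Suc p"] by simp
  qed
  have "(\<Sum>p=1..N. T p) = 3/2 * (3 ^ N - 1) * a powr k + S 1 - S (Suc N)" if "N \<le> n" for N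
    using that
  proof (induction N)
    case (Suc N)
    have "T (Suc N) = 3 ^ Suc N * a powr k + S (Suc N) - S (Suc (Suc N))"
      using step[of "Suc N"] defd[of N] Suc.prems by simp
    moreover have "(\<Sum>p=1..N. T p) = 3/2 * (3 ^ N - 1) * a powr k + S 1 - S (Suc N)"
      using Suc by simp
    moreover have "(\<Sum>p=1..Suc N. T p) = (\<Sum>p=1..N. T p) + T (Suc N)" by simp
    ultimately show ?case by (simp only:) (simp add: field_simps)
  qed simp
  from this[of n] have "(\<Sum>p=1..n. T p) = 3/2 * (3 ^ n - 1) * a powr k + S 1 - S (Suc n)" by simp
  thus ?thesis
    unfolding \<omega>2 \<omega>_def[symmetric] T_def S_def x_def w_def K_def by (simp add: algebra_simps diff_divide_distrib)
qed

end
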